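(* Let $\mathcal{C}, \mathcal{C}'$ be $k$-clusterings of the same data set for which the edge set of $CDG(\mathcal{C},\mathcal{C}')$ consists of (is the edge-disjoint union of) a nonempty set $\mathcal{Y}$ of pairwise vertex-disjoint directed cycles and a directed path $P$. If $P$ intersects $\mathcal{Y}$ at most three times, i.e. at most three vertices of $P$ lie on cycles of $\mathcal{Y}$, then $d(\mathcal{C},\mathcal{C}') = 2$.
   Context: A $k$-clustering of a finite data set $X=\{x_1,\dots,x_n\}$ is an ordered partition $\mathcal{C}=(C_1,\dots,C_k)$ of $X$ into $k$ labeled (possibly empty) clusters, each item lying in exactly one cluster. For two $k$-clusterings $\mathcal{C}=(C_1,\dots,C_k)$, $\mathcal{C}'=(C_1',\dots,C_k')$ of $X$, the clustering-difference graph $CDG(\mathcal{C},\mathcal{C}')$ is the directed arc-labeled multigraph with vertex set $\{c_1,\dots,c_k\}$ having an edge $(c_i,c_j)$ with label $x_\ell$ if and only if $i\neq j$, $x_\ell\in C_i$ and $x_\ell\in C_j'$. Parallel edges are allowed (all labels are distinct). Directed cycles and directed paths have no repeated vertices; paths have at least one edge. A cyclical move transforms a $k$-clustering $\mathcal{A}$ into a $k$-clustering $\mathcal{B}$ of the same data set for which the edges of $CDG(\mathcal{A},\mathcal{B})$ form a single directed cycle; a sequential move transforms $\mathcal{A}$ into $\mathcal{B}$ for which the edges of $CDG(\mathcal{A},\mathcal{B})$ form a single directed path. The transformation distance $d(\mathcal{C},\mathcal{C}')$ is the minimum number of cyclical and sequential moves needed to transform $\mathcal{C}$ into $\mathcal{C}'$.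 *)

theory Defs
  imports "Graph_Theory.Arc_Walk"
begin

text \<open>
  A clustering is a list of clusters, so that the clusters are labelled \<open>0, \<dots>, k - 1\<close> and two
  clusterings are equal as ordered partitions iff they are equal as lists.
\<close>

definition clustering :: "nat \<Rightarrow> 'a set \<Rightarrow> 'a set list \<Rightarrow> bool" where
  "clustering k X C \<longleftrightarrow>
     length C = k \<and> (\<Union>i<k. C ! i) = X \<and>
     (\<forall>i<k. \<forall>j<k. i \<noteq> j \<longrightarrow> C ! i \<inter> C ! j = {})"

text \<open>
  The arc \<open>(i, x, j)\<close> runs from \<open>i\<close> to \<open>j\<close> and is labelled with the item \<open>x\<close>, so arcs with the
  same end points but different labels are different arcs.
\<close>

definition CDG :: "nat \<Rightarrow> 'a set list \<Rightarrow> 'a set list \<Rightarrow> (nat, nat \<times> 'a \<times> nat) pre_digraph" where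
  "CDG k C C' =
     \<lparr> verts = {..<k},
       arcs = {(i, x, j). i < k \<and> j < k \<and> i \<noteq> j \<and> x \<in> C ! i \<and> x \<in> C' ! j},
       tail = (\<lambda>(i, x, j). i),
       head = (\<lambda>(i, x, j). j) \<rparr>"

definition directed_path :: "('v, 'e) pre_digraph \<Rightarrow> 'e list \<Rightarrow> bool" where
  "directed_path G p \<longleftrightarrow> p \<noteq> [] \<and> (\<exists>u v. pre_digraph.apath G u p v)"

text \<open>
  The notion \<open>pre_digraph.cycle\<close> admits loops and cycles of length two; a clustering-difference
  graph has no loops.
\<close>

abbreviation directed_cycle :: "('v, 'e) pre_digraph \<Rightarrow> 'e list \<Rightarrow> bool" where
  "directed_cycle G p \<equiv> pre_digraph.cycle G p"

definition walk_vertices :: "('v, 'e) pre_digraph \<Rightarrow> 'e list \<Rightarrow> 'v set" where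
  "walk_vertices G p = tail G ` set p \<union> head G ` set p"

definition cyclical_move :: "nat \<Rightarrow> 'a set \<Rightarrow> 'a set list \<Rightarrow> 'a set list \<Rightarrow> bool" where
  "cyclical_move k X A B \<longleftrightarrow>
     clustering k X A \<and> clustering k X B \<and>
     (\<exists>p. directed_cycle (CDG k A B) p \<and> set p = arcs (CDG k A B))"

definition sequential_move :: "nat \<Rightarrow> 'a set \<Rightarrow> 'a set list \<Rightarrow> 'a set list \<Rightarrow> bool" where
  "sequential_move k X A B \<longleftrightarrow>
     clustering k X A \<and> clustering k X B \<and>
     (\<exists>p. directed_path (CDG k A B) p \<and> set p = arcs (CDG k A B))"

definition move :: "nat \<Rightarrow> 'a set \<Rightarrow> 'a set list \<Rightarrow> 'a set list \<Rightarrow> bool" where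
  "move k X A B \<longleftrightarrow> cyclical_move k X A B \<or> sequential_move k X A B"

text \<open>
  For clusterings of a finite set the minimum is over a nonempty set of numbers, because
  relocating a single item is a sequential move (a path with one arc).
\<close>

definition transformation_distance :: "nat \<Rightarrow> 'a set \<Rightarrow> 'a set list \<Rightarrow> 'a set list \<Rightarrow> nat" where
  "transformation_distance k X C C' = (LEAST n. (move k X ^^ n) C C')"

end

theory Submission
  imports Defs
begin

(*
  The first move may send an item to a wrong cluster, to be corrected by the second move. Swapping
  the targets of an item on a walk and of an item on a vertex-disjoint cycle merges the walk and
  the cycle into a single walk. If the former item is moved twice anyway, then the correction only
  adds one vertex to the second move. So it suffices to treat the path together with one or two of
  the cycles, such that some item is moved twice and the remaining cycles stay away from the first
  move and are not covered by the second one. Which two cycles to choose depends on the cycles of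
  the first and of the last vertex that the path shares with a cycle; with at most three shared
  vertices, few patterns are possible. One move never suffices because the arcs of a path or cycle
  contain no cycle as a proper part.
*)

section \<open>Walks of labelled arcs\<close>

text \<open>A merger is cheap next to an item that is moved twice. Let \<open>y\<close> go from
  \<open>p\<close> to \<open>b\<close>, and let the cycle have an item \<open>x\<close> going from
  \<open>u\<close> to \<open>v\<close>. After the exchange \<open>y\<close> sits at \<open>v\<close>
  and \<open>x\<close> at \<open>b\<close>. If \<open>b\<close> was the final target of
  \<open>y\<close>, the correction is a two-cycle between \<open>b\<close> and \<open>v\<close>, in
  general separate from the rest of the second move. If \<open>y\<close> has to go on from
  \<open>b\<close> to \<open>b'\<close> anyway, the correction is the detour from \<open>b\<close>
  over \<open>v\<close> to \<open>b'\<close>, which subdivides an arc of the second move. Now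
  \<open>x\<close> is moved twice, again over \<open>b\<close>, so the same vertex serves any number
  of further cycles. A cycle qualifies if it avoids the first move and has a vertex outside the
  second. All cases but \<open>solvable_single_cycle\<close> thus have two tasks: to spread the arcs
  of the path and the chosen cycles over two simple walks, with one arc from \<open>p\<close> to
  \<open>b'\<close> broken up at a vertex \<open>b\<close>, and to make all other cycles qualify.
  Simplicity is the obstacle, since vertices of the chosen cycles may lie on the path as well; the
  bound on the shared vertices controls this.\<close>

fun walk :: "'v \<Rightarrow> ('v \<times> 'a \<times> 'v) list \<Rightarrow> 'v \<Rightarrow> bool" where
  "walk u [] v \<longleftrightarrow> u = v" |
  "walk u ((i, x, j) # p) v \<longleftrightarrow> i = u \<and> walk j p v"

definition tails :: "('v \<times> 'a \<times> 'v) list \<Rightarrow> 'v set" where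
  "tails p = fst ` set p"

definition heads :: "('v \<times> 'a \<times> 'v) list \<Rightarrow> 'v set" where
  "heads p = (\<lambda>e. snd (snd e)) ` set p"

abbreviation ends :: "('v \<times> 'a \<times> 'v) list \<Rightarrow> 'v set" where
  "ends p \<equiv> tails p \<union> heads p"

definition labels :: "('v \<times> 'a \<times> 'v) list \<Rightarrow> 'a set" where
  "labels p = (\<lambda>e. fst (snd e)) ` set p"

text \<open>
  A walk satisfying this predicate is a directed path or, if its end points coincide, a directed
  cycle.
\<close>

definition simple :: "('v \<times> 'a \<times> 'v) list \<Rightarrow> bool" where
  "simple p \<longleftrightarrow> distinct (map fst p) \<and> distinct (map (\<lambda>e. snd (snd e)) p)"

lemma tails_simps [simp]:
  "tails [] = {}" "tails ((i, x, j) # p) = insert i (tails p)" "tails (p @ q) = tails p \<union> tails q"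
  by (auto simp: tails_def)

lemma heads_simps [simp]:
  "heads [] = {}" "heads ((i, x, j) # p) = insert j (heads p)" "heads (p @ q) = heads p \<union> heads q"
  by (auto simp: heads_def)

lemma simple_simps [simp]:
  "simple []" "simple ((i, x, j) # p) \<longleftrightarrow> i \<notin> tails p \<and> j \<notin> heads p \<and> simple p"
  "simple (p @ q) \<longleftrightarrow>
     simple p \<and> simple q \<and> tails p \<inter> tails q = {} \<and> heads p \<inter> heads q = {}"
  by (auto simp: simple_def tails_def heads_def)

lemma walk_append [simp]: "walk u (p @ q) v \<longleftrightarrow> (\<exists>w. walk u p w \<and> walk w q v)"
  by (induction u p v rule: walk.induct) auto

text \<open>Every head is the tail of the next arc, except the last head, which is \<open>v\<close>.
  Inserting both end points gives one equation for empty, open and closed walks.\<close>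

lemma walk_tails_heads: "walk u p v \<Longrightarrow> insert v (tails p) = insert u (heads p)"
  by (induction u p v rule: walk.induct) auto

lemma closed_walk_tails_heads:
  assumes "walk u p u"
  shows "tails p = heads p"
proof (cases "p = []")
  case False
  then have "u \<in> tails p" "u \<in> heads p"
    using assms by (cases p, auto, cases p rule: rev_cases, auto)
  then show ?thesis
    using walk_tails_heads[OF assms] by auto
qed auto

lemma arcs_mem:
  "(i, x, j) \<in> set p \<Longrightarrow> i \<in> tails p" "(i, x, j) \<in> set p \<Longrightarrow> j \<in> heads p"
  "(i, x, j) \<in> set p \<Longrightarrow> x \<in> labels p"
  by (force simp: tails_def heads_def labels_def)+

lemma simple_distinct: "simple p \<Longrightarrow> distinct p"
  by (auto simp: simple_def distinct_map)

lemma tails_heads_cong: "set p = set q \<Longrightarrow> tails p = tails q \<and> heads p = heads q"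
  by (simp add: tails_def heads_def)

text \<open>The set \<open>insert u (heads p)\<close> consists of the vertices of the walk, also if
  the walk is empty.\<close>

lemma walk_split_vertex:
  assumes "walk u p v" "w \<in> insert u (heads p)"
  obtains p1 p2 where "p = p1 @ p2" "walk u p1 w" "walk w p2 v"
proof -
  have "\<exists>p1 p2. p = p1 @ p2 \<and> walk u p1 w \<and> walk w p2 v"
    using assms
  proof (induction u p v rule: walk.induct)
    case (2 u i x j p v)
    show ?case
    proof (cases "w = u")
      case True
      then show ?thesis using 2 by (intro exI[of _ "[]"] exI[of _ "(i, x, j) # p"]) auto
    next
      case False
      then obtain p1 p2 where "p = p1 @ p2 \<and> walk j p1 w \<and> walk w p2 v"
        using 2 by auto
      then show ?thesis using 2
        by (intro exI[of _ "(i, x, j) # p1"] exI[of _ p2]) auto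
    qed
  qed auto
  then show ?thesis using that by blast
qed

text \<open>The vertices of \<open>p1\<close> before its end are tails of \<open>p1\<close>, so
  \<open>w\<close> is the first vertex of the walk in \<open>W\<close>. In
  \<open>walk_split_last\<close> heads play this role for the last one.\<close>

lemma walk_split_first:
  assumes "walk u p v" "insert u (heads p) \<inter> W \<noteq> {}"
  obtains p1 p2 w where "p = p1 @ p2" "walk u p1 w" "walk w p2 v" "w \<in> W" "tails p1 \<inter> W = {}"
proof -
  have "\<exists>p1 p2 w. p = p1 @ p2 \<and> walk u p1 w \<and> walk w p2 v \<and> w \<in> W \<and> tails p1 \<inter> W = {}"
    using assms
  proof (induction u p v rule: walk.induct)
    case (2 u i x j p v)
    show ?case
    proof (cases "u \<in> W")
      case True
      then show ?thesis using 2 by (intro exI[of _ "[]"] exI[of _ "(i, x, j) # p"]) auto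
    next
      case False
      then obtain p1 p2 w where
        "p = p1 @ p2 \<and> walk j p1 w \<and> walk w p2 v \<and> w \<in> W \<and> tails p1 \<inter> W = {}"
        using 2 by auto
      then show ?thesis using 2 False
        by (intro exI[of _ "(i, x, j) # p1"] exI[of _ p2] exI[of _ w]) simp
    qed
  qed auto
  then show ?thesis using that by blast
qed

lemma walk_split_last:
  assumes "walk u p v" "insert u (heads p) \<inter> W \<noteq> {}"
  obtains p1 p2 w where "p = p1 @ p2" "walk u p1 w" "walk w p2 v" "w \<in> W" "heads p2 \<inter> W = {}"
proof -
  have "\<exists>p1 p2 w. p = p1 @ p2 \<and> walk u p1 w \<and> walk w p2 v \<and> w \<in> W \<and> heads p2 \<inter> W = {}"
    using assms
  proof (induction u p v rule: walk.induct)
    case (2 u i x j p v)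
    show ?case
    proof (cases "insert j (heads p) \<inter> W = {}")
      case True
      then show ?thesis using 2 by (intro exI[of _ "[]"] exI[of _ "(i, x, j) # p"]) auto
    next
      case False
      then obtain p1 p2 w where
        "p = p1 @ p2 \<and> walk j p1 w \<and> walk w p2 v \<and> w \<in> W \<and> heads p2 \<inter> W = {}"
        using 2 by auto
      then show ?thesis using 2 False
        by (intro exI[of _ "(i, x, j) # p1"] exI[of _ p2] exI[of _ w]) simp
    qed
  qed auto
  then show ?thesis using that by blast
qed

section \<open>Simple cycles and their minimality\<close>

definition simple_cycle :: "('v \<times> 'a \<times> 'v) list \<Rightarrow> bool" where
  "simple_cycle p \<longleftrightarrow> p \<noteq> [] \<and> simple p \<and> (\<exists>u. walk u p u)"

lemma simple_cycle_tails_heads: "simple_cycle p \<Longrightarrow> tails p = heads p"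
  by (auto simp: simple_cycle_def closed_walk_tails_heads)

lemma simple_cycle_rotate:
  assumes "simple_cycle p" "w \<in> ends p"
  obtains q where "walk w q w" "simple q" "q \<noteq> []" "set q = set p"
proof -
  obtain u where u: "walk u p u" "p \<noteq> []" "simple p"
    using assms by (auto simp: simple_cycle_def)
  have "w \<in> insert u (heads p)"
    using assms simple_cycle_tails_heads by blast
  then obtain p1 p2 where p: "p = p1 @ p2" "walk u p1 w" "walk w p2 u"
    using u walk_split_vertex by metis
  have "walk w (p2 @ p1) w" using p by auto
  moreover have "simple (p2 @ p1)" using p u by auto
  ultimately show ?thesis using that[of "p2 @ p1"] p u by auto
qed

text \<open>A simple walk has at most one arc into and one arc out of each vertex. The successor and
  the predecessor that \<open>K\<close> provides are therefore the neighbours in the list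
  \<open>p\<close>, and membership in \<open>K\<close> spreads along the whole list.\<close>

lemma simple_closed_subset:
  assumes "walk u p v" "simple p" "K \<subseteq> set p" "K \<noteq> {}"
    and succ: "\<And>i x j. (i, x, j) \<in> K \<Longrightarrow> \<exists>y l. (j, y, l) \<in> K"
    and pred: "\<And>i x j. (i, x, j) \<in> K \<Longrightarrow> \<exists>y l. (l, y, i) \<in> K"
  shows "set p \<subseteq> K"
proof -
  have step: "p ! n \<in> K \<longleftrightarrow> p ! Suc n \<in> K" if "Suc n < length p" for n
  proof -
    have p: "p = take n p @ p ! n # p ! Suc n # drop (Suc (Suc n)) p"
      using that by (simp add: Cons_nth_drop_Suc)
    obtain i x j where a: "p ! n = (i, x, j)" by (cases "p ! n")
    obtain i' x' j' where b: "p ! Suc n = (i', x', j')" by (cases "p ! Suc n")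
    have "walk u (take n p @ p ! n # p ! Suc n # drop (Suc (Suc n)) p) v"
      using assms(1) p by simp
    then have "i' = j" using a b by auto
    have inj: "e = e'" if "e \<in> set p" "e' \<in> set p"
      "fst e = fst e' \<or> snd (snd e) = snd (snd e')" for e e'
      using that assms(2) unfolding simple_def by (auto simp: distinct_map dest: inj_onD)
    have mem: "(i, x, j) \<in> set p" "(j, x', j') \<in> set p"
      using that a b \<open>i' = j\<close> by (metis nth_mem Suc_lessD)+
    show ?thesis
    proof
      assume "p ! n \<in> K"
      then obtain y l where y: "(j, y, l) \<in> K" using succ a by metis
      then have "(j, y, l) = (j, x', j')" using inj mem assms(3) by (metis fst_conv subsetD)
      then show "p ! Suc n \<in> K" using y b \<open>i' = j\<close> by simp
    next
      assume "p ! Suc n \<in> K"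
      then obtain y l where y: "(l, y, j) \<in> K" using pred b \<open>i' = j\<close> by metis
      then have "(l, y, j) = (i, x, j)" using inj mem assms(3) by (metis snd_conv subsetD)
      then show "p ! n \<in> K" using y a by simp
    qed
  qed
  obtain m where m: "m < length p" "p ! m \<in> K"
    using assms(3,4) by (metis ex_in_conv in_set_conv_nth subsetD)
  have iff0: "n < length p \<Longrightarrow> p ! n \<in> K \<longleftrightarrow> p ! 0 \<in> K" for n
    by (induction n) (use step in auto)
  show ?thesis
    using iff0 m by (metis in_set_conv_nth subsetI)
qed

text \<open>This rules out a single move. Every arc of a cycle has a successor and a predecessor in
  the cycle, so \<open>simple_closed_subset\<close> applies.\<close>

lemma simple_cycle_subset_eq:
  assumes "walk u p v" "simple p" "simple_cycle q" "set q \<subseteq> set p"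
  shows "set q = set p"
proof -
  have "tails q = heads q" using assms(3) by (rule simple_cycle_tails_heads)
  then have "j \<in> tails q" "i \<in> heads q" if "(i, x, j) \<in> set q" for i x j
    using arcs_mem[OF that] by auto
  then have "\<exists>y l. (j, y, l) \<in> set q" "\<exists>y l. (l, y, i) \<in> set q" if "(i, x, j) \<in> set q" for i x j
    using that by (fastforce simp: tails_def, fastforce simp: heads_def)
  then have "set p \<subseteq> set q"
    using assms by (intro simple_closed_subset[of u p v]) (auto simp: simple_cycle_def)
  then show ?thesis using assms(4) by blast
qed

text \<open>The tails are \<open>u\<close> and the heads of all arcs but the last. The last arc
  already enters \<open>v\<close>, and \<open>simple\<close> allows no second arc to do so.\<close>

lemma simple_open_walk_target:
  assumes "walk u p v" "simple p" "u \<noteq> v"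
  shows "v \<notin> tails p"
proof (cases p rule: rev_cases)
  case (snoc q e)
  obtain i x j where e: "e = (i, x, j)" by (cases e)
  have *: "walk u q i" "v \<notin> heads q" "j = v" "p = q @ [(i, x, v)]"
    using assms snoc e by auto
  then have "insert i (tails q) = insert u (heads q)" by (intro walk_tails_heads)
  then have "v \<notin> insert i (tails q)" using * assms by auto
  then show ?thesis using * by auto
qed auto

lemma simple_open_walk_source:
  assumes "walk u p v" "simple p" "u \<noteq> v"
  shows "u \<notin> heads p"
proof (cases p)
  case (Cons e q)
  then obtain x j where p: "p = (u, x, j) # q" "walk j q v" "u \<notin> tails q"
    using assms by (cases e) auto
  then have "insert v (tails q) = insert j (heads q)" by (intro walk_tails_heads)
  then have "u \<notin> insert j (heads q)" using p assms by auto
  then show ?thesis using p by auto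
qed auto

lemma walk_ends_subset: "walk u p v \<Longrightarrow> ends p \<subseteq> insert u (heads p)" "walk u p v \<Longrightarrow> ends p \<subseteq> insert v (tails p)"
  by (drule walk_tails_heads, blast)+

lemma walk_in_tails: "walk u p v \<Longrightarrow> p \<noteq> [] \<Longrightarrow> u \<in> tails p"
  by (cases p) auto

lemma walk_in_heads: "walk u p v \<Longrightarrow> p \<noteq> [] \<Longrightarrow> v \<in> heads p"
  by (cases p rule: rev_cases) auto

section \<open>Clustering-difference graphs\<close>

text \<open>Arcs carry their own end points, so \<open>walk\<close> does not refer to a digraph.
  This allows arcs of different difference graphs to be spliced into one list.\<close>

lemma cas_CDG: "pre_digraph.cas (CDG k C C') u p v \<longleftrightarrow> walk u p v"
  by (induction u p v rule: walk.induct) (auto simp: pre_digraph.cas.simps CDG_def)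

lemma CDG_tail_head:
  "tail (CDG k C C') = fst" "head (CDG k C C') = (\<lambda>e. snd (snd e))"
  by (auto simp: CDG_def)

lemma walk_vertices_CDG: "walk_vertices (CDG k C C') p = ends p"
  by (simp add: walk_vertices_def CDG_tail_head tails_def heads_def)

lemma directed_cycle_CDG:
  "directed_cycle (CDG k C C') p \<longleftrightarrow> simple_cycle p \<and> set p \<subseteq> arcs (CDG k C C')"
proof
  assume "directed_cycle (CDG k C C') p"
  then obtain u where u: "pre_digraph.awalk (CDG k C C') u p u"
    "distinct (tl (pre_digraph.awalk_verts (CDG k C C') u p))" "p \<noteq> []"
    by (auto simp: pre_digraph.cycle_def)
  then have w: "walk u p u" "set p \<subseteq> arcs (CDG k C C')"
    by (auto simp: pre_digraph.awalk_def cas_CDG)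
  have hd: "distinct (map (\<lambda>e. snd (snd e)) p)"
    using u w by (simp add: pre_digraph.awalk_verts_conv' cas_CDG CDG_tail_head)
  \<comment> \<open>Only the heads are known to be distinct. On a closed walk they form the same set
    as the tails, so distinctness of the tails follows by counting.\<close>
  have "card (set (map fst p)) = length (map fst p)"
    using closed_walk_tails_heads[OF w(1)] distinct_card[OF hd] by (simp add: tails_def heads_def)
  then have "distinct (map fst p)" by (rule card_distinct)
  then show "simple_cycle p \<and> set p \<subseteq> arcs (CDG k C C')"
    using hd w u by (auto simp: simple_cycle_def simple_def)
next
  assume p: "simple_cycle p \<and> set p \<subseteq> arcs (CDG k C C')"
  then obtain u where u: "walk u p u" "simple p" "p \<noteq> []" by (auto simp: simple_cycle_def)
  then have "u \<in> verts (CDG k C C')"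
    using p by (cases p) (auto simp: CDG_def)
  then have "pre_digraph.awalk (CDG k C C') u p u"
    using u p by (simp add: pre_digraph.awalk_def cas_CDG)
  then show "directed_cycle (CDG k C C') p"
    using u by (auto simp: pre_digraph.cycle_def pre_digraph.awalk_verts_conv' cas_CDG CDG_tail_head
        simple_def)
qed

text \<open>The vertex list of a nonempty walk is the first tail followed by all heads, and also all
  tails followed by the last head. The two descriptions yield both halves of \<open>simple\<close>
  and \<open>u \<noteq> v\<close>.\<close>

lemma directed_path_CDG:
  "directed_path (CDG k C C') p \<longleftrightarrow>
     p \<noteq> [] \<and> simple p \<and> set p \<subseteq> arcs (CDG k C C') \<and> (\<exists>u v. u \<noteq> v \<and> walk u p v)"
proof
  assume "directed_path (CDG k C C') p"
  then obtain u v where u: "pre_digraph.awalk (CDG k C C') u p v"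
    "distinct (pre_digraph.awalk_verts (CDG k C C') u p)" "p \<noteq> []"
    by (auto simp: directed_path_def pre_digraph.apath_def)
  then have w: "walk u p v" "set p \<subseteq> arcs (CDG k C C')"
    by (auto simp: pre_digraph.awalk_def cas_CDG)
  have "distinct (map (\<lambda>e. snd (snd e)) p)" "fst (hd p) \<notin> heads p"
    using u w by (simp_all add: pre_digraph.awalk_verts_conv' cas_CDG CDG_tail_head heads_def)
  moreover have "distinct (map fst p)"
    using u w by (simp add: pre_digraph.awalk_verts_conv CDG_tail_head)
  moreover have "fst (hd p) = u" "v \<in> heads p"
    using w u by (cases p, auto, cases p rule: rev_cases, auto)
  ultimately have "simple p" "u \<noteq> v" by (auto simp: simple_def)
  then show "p \<noteq> [] \<and> simple p \<and> set p \<subseteq> arcs (CDG k C C') \<and> (\<exists>u v. u \<noteq> v \<and> walk u p v)"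
    using w u by blast
next
  assume p: "p \<noteq> [] \<and> simple p \<and> set p \<subseteq> arcs (CDG k C C') \<and> (\<exists>u v. u \<noteq> v \<and> walk u p v)"
  then obtain u v where u: "walk u p v" "u \<noteq> v" by auto
  then have "u \<in> verts (CDG k C C')"
    using p by (cases p) (auto simp: CDG_def)
  then have w: "pre_digraph.awalk (CDG k C C') u p v"
    using u p by (simp add: pre_digraph.awalk_def cas_CDG)
  have v: "snd (snd (last p)) = v"
    using u p by (cases p rule: rev_cases) auto
  have "v \<notin> fst ` set p"
    using simple_open_walk_target[OF u(1) _ u(2)] p by (simp add: tails_def)
  with v have v: "snd (snd (last p)) \<notin> fst ` set p" by simp
  show "directed_path (CDG k C C') p"
  proof -
    have "distinct (pre_digraph.awalk_verts (CDG k C C') u p)"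
      using p v by (simp add: pre_digraph.awalk_verts_conv CDG_tail_head simple_def)
    then show ?thesis
      using p w unfolding directed_path_def pre_digraph.apath_def by blast
  qed
qed

text \<open>A walk is either closed or open. With both kinds of moves under one roof, the
  constructions need not care whether a walk closes up.\<close>

lemma move_iff:
  "move k X A B \<longleftrightarrow> clustering k X A \<and> clustering k X B \<and>
     (\<exists>p u v. p \<noteq> [] \<and> walk u p v \<and> simple p \<and> set p = arcs (CDG k A B))"
proof -
  have "(\<exists>u v. walk u p v) \<longleftrightarrow> (\<exists>u. walk u p u) \<or> (\<exists>u v. u \<noteq> v \<and> walk u p v)"
    for p :: "(nat \<times> 'a \<times> nat) list"
    by metis
  then show ?thesis
    unfolding move_def cyclical_move_def sequential_move_def directed_cycle_CDG directed_path_CDG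
      simple_cycle_def
    by (auto 0 3)
qed

section \<open>Clusterings as maps from items to cluster numbers\<close>

definition position :: "'a set list \<Rightarrow> 'a \<Rightarrow> nat" where
  "position C x = (SOME i. i < length C \<and> x \<in> C ! i)"

lemma clustering_position:
  assumes "clustering k X C"
  shows "x \<in> X \<Longrightarrow> position C x < k" "i < k \<Longrightarrow> x \<in> C ! i \<longleftrightarrow> x \<in> X \<and> position C x = i"
proof -
  have C: "length C = k" "(\<Union>i<k. C ! i) = X" "\<And>i j. i < k \<Longrightarrow> j < k \<Longrightarrow> i \<noteq> j \<Longrightarrow> C ! i \<inter> C ! j = {}"
    using assms by (auto simp: clustering_def)
  have p: "position C x < k \<and> x \<in> C ! position C x" if x: "x \<in> X" for x
  proof -
    obtain i where "i < length C \<and> x \<in> C ! i" using C x by blast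
    then show ?thesis
      unfolding position_def using someI[of "\<lambda>i. i < length C \<and> x \<in> C ! i"] C by simp
  qed
  show "x \<in> X \<Longrightarrow> position C x < k" using p by blast
  show "i < k \<Longrightarrow> x \<in> C ! i \<longleftrightarrow> x \<in> X \<and> position C x = i" using p C by blast
qed

text \<open>For position maps these are the arcs of the difference graph. The item set
  \<open>N\<close> makes it possible to describe parts of the graph, such as a single cycle, through
  their labels.\<close>

definition arcs_between :: "('a \<Rightarrow> 'v) \<Rightarrow> ('a \<Rightarrow> 'v) \<Rightarrow> 'a set \<Rightarrow> ('v \<times> 'a \<times> 'v) set" where
  "arcs_between c d N = (\<lambda>x. (c x, x, d x)) ` {x \<in> N. c x \<noteq> d x}"

lemma mem_arcs_between [simp]:
  "(i, x, j) \<in> arcs_between c d N \<longleftrightarrow> x \<in> N \<and> i = c x \<and> j = d x \<and> i \<noteq> j"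
  by (auto simp: arcs_between_def)

lemma arcs_between_remove: "arcs_between c d (N - {y}) = arcs_between c d N - {(c y, y, d y)}"
  by auto

lemma arcs_between_labelsD:
  assumes "set Z \<subseteq> arcs_between c c' A" "x \<in> labels Z"
  shows "x \<in> A \<and> c x \<noteq> c' x \<and> (c x, x, c' x) \<in> set Z"
proof -
  obtain i j where "(i, x, j) \<in> set Z" using assms(2) by (auto simp: labels_def)
  moreover from this have "(i, x, j) \<in> arcs_between c c' A" using assms(1) by blast
  ultimately show ?thesis by (auto simp only: mem_arcs_between)
qed

text \<open>An item labels at most one arc, from its old to its new position, so sets of arcs can be
  handled as sets of items.\<close>

lemma set_arcs_between_labels:
  assumes "set Z \<subseteq> arcs_between c c' A"
  shows "set Z = arcs_between c c' (labels Z)"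
proof (rule set_eqI)
  fix e :: "'a \<times> 'b \<times> 'a"
  obtain i x j where e: "e = (i, x, j)" by (cases e)
  have "(i, x, j) \<in> set Z \<Longrightarrow> (i, x, j) \<in> arcs_between c c' A" using assms by blast
  then show "e \<in> set Z \<longleftrightarrow> e \<in> arcs_between c c' (labels Z)"
    using arcs_between_labelsD[OF assms, of x] arcs_mem(3)[of i x j Z] unfolding e
    by (simp only: mem_arcs_between) blast
qed

lemma arcs_CDG:
  assumes "clustering k X C" "clustering k X D"
  shows "arcs (CDG k C D) = arcs_between (position C) (position D) X"
  using clustering_position[OF assms(1)] clustering_position[OF assms(2)]
  by (auto simp: CDG_def)

text \<open>As clusters may be empty, any choice of intermediate positions below \<open>k\<close> is
  legitimate.\<close>

lemma clustering_from_positions: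
  assumes "d ` X \<subseteq> {..<k}"
  obtains D where "clustering k X D" "\<And>x. x \<in> X \<Longrightarrow> position D x = d x"
proof -
  define D where "D = map (\<lambda>i. {x \<in> X. d x = i}) [0..<k]"
  have nth: "D ! i = {x \<in> X. d x = i}" if "i < k" for i using that by (simp add: D_def)
  have cl: "clustering k X D"
    unfolding clustering_def using assms by (auto simp: nth) (simp add: D_def)
  moreover have "position D x = d x" if "x \<in> X" for x
    using clustering_position(2)[OF cl, of "d x" x] nth[of "d x"] assms that by auto
  ultimately show ?thesis using that by blast
qed

section \<open>Two consecutive moves\<close>

text \<open>
  An item of \<open>N\<close> goes from \<open>c x\<close> to \<open>d x\<close> along \<open>M\<close> and from there to \<open>c' x\<close> along \<open>M'\<close>.
\<close>

definition two_step ::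
  "('a \<Rightarrow> 'v) \<Rightarrow> ('a \<Rightarrow> 'v) \<Rightarrow> 'a set \<Rightarrow> ('v \<times> 'a \<times> 'v) list \<Rightarrow> ('v \<times> 'a \<times> 'v) list \<Rightarrow> bool"
where
  "two_step c c' N M M' \<longleftrightarrow>
     (\<exists>u v. walk u M v) \<and> simple M \<and> (\<exists>u v. walk u M' v) \<and> simple M' \<and>
     (\<exists>d. set M = arcs_between c d N \<and> set M' = arcs_between d c' N)"

lemma two_step_moves:
  assumes C: "clustering k X C" "clustering k X C'"
    and N: "N = {x \<in> X. position C x \<noteq> position C' x}"
    and M: "two_step (position C) (position C') N M M'" "M \<noteq> []" "M' \<noteq> []" "heads M \<subseteq> {..<k}"
  shows "(move k X OO move k X) C C'"
proof -
  obtain d where d: "set M = arcs_between (position C) d N" "set M' = arcs_between d (position C') N"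
    using M by (auto simp: two_step_def)
  \<comment> \<open>The map \<open>d\<close> is controlled on \<open>N\<close> only. The other items
    stay where they are, which is also where they belong, so they add no arcs to either
    move.\<close>
  define e where "e = (\<lambda>x. if x \<in> N then d x else position C x)"
  have "d x < k" if "x \<in> N" for x
  proof (cases "d x = position C x")
    case True
    then show ?thesis using clustering_position(1)[OF C(1)] N that by auto
  next
    case False
    then have "(position C x, x, d x) \<in> set M" using d that by auto
    then show ?thesis using M(4) arcs_mem(2)[of _ _ _ M] by blast
  qed
  then have "e ` X \<subseteq> {..<k}"
    using clustering_position(1)[OF C(1)] by (auto simp: e_def)
  then obtain D where D: "clustering k X D" "\<And>x. x \<in> X \<Longrightarrow> position D x = e x"
    using clustering_from_positions by blast
  have "set M = arcs (CDG k C D)" "set M' = arcs (CDG k D C')"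
    unfolding arcs_CDG[OF C(1) D(1)] arcs_CDG[OF D(1) C(2)] d using N D(2)
    by (auto simp: e_def split: if_splits)
  then have "move k X C D" "move k X D C'"
    using M C D by (auto simp: move_iff two_step_def)
  then show ?thesis by blast
qed

text \<open>Every item is carried straight to its target in one of the two moves, except
  \<open>y\<close>, whose arc from \<open>p\<close> to \<open>b'\<close> is broken up at
  \<open>b\<close>.\<close>

lemma two_stepI:
  assumes "walk u M v" "simple M" "walk u' M' v'" "simple M'"
    and M: "set M = insert (p, y, b) S" "set M' = insert (b, y, b') S'" "p \<noteq> b" "b \<noteq> b'"
    and S: "S \<union> S' \<union> {(p, y, b')} = arcs_between c c' N" "S \<inter> S' = {}" "(p, y, b') \<notin> S \<union> S'"
    and N: "\<And>x. x \<in> N \<Longrightarrow> c x \<noteq> c' x"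
  shows "two_step c c' N M M'"
proof -
  \<comment> \<open>Between the moves \<open>y\<close> waits at \<open>b\<close>, the items of
    \<open>S\<close> have arrived and those of \<open>S'\<close> have not yet left.\<close>
  define d where "d = (\<lambda>x. if x = y then b else if (c x, x, c' x) \<in> S then c' x else c x)"
  have mem: "(c x, x, c' x) \<in> S \<union> S' \<union> {(p, y, b')}" if "x \<in> N" for x
    using that N by (simp only: S) simp
  have arc: "x \<in> N \<and> i = c x \<and> j = c' x" if "(i, x, j) \<in> S \<union> S' \<union> {(p, y, b')}" for i x j
    using that unfolding S by simp
  have y: "y \<in> N" "p = c y" "b' = c' y" using arc[of p y b'] by auto
  have "e \<in> set M \<longleftrightarrow> e \<in> arcs_between c d N" for e
  proof (cases e)
    case (fields i x j)
    show ?thesis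
      unfolding fields M using y arc[of i x j] S(2,3) N[of x] \<open>p \<noteq> b\<close> by (auto simp: d_def)
  qed
  moreover have "e \<in> set M' \<longleftrightarrow> e \<in> arcs_between d c' N" for e
  proof (cases e)
    case (fields i x j)
    show ?thesis
      unfolding fields M using y arc[of i x j] mem[of x] S(2,3) N[of x] \<open>b \<noteq> b'\<close>
      by (auto simp: d_def)
  qed
  ultimately show ?thesis
    using assms unfolding two_step_def by (intro conjI exI[of _ d]) blast+
qed

section \<open>Absorbing cycles at an item that is moved twice\<close>

definition linked :: "('v \<times> 'a \<times> 'v) list \<Rightarrow> ('v \<times> 'a \<times> 'v) list \<Rightarrow> bool" where
  "linked M M' \<longleftrightarrow> (\<exists>y L p b R L' b' R'. M = L @ (p, y, b) # R \<and> M' = L' @ (b, y, b') # R')"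

text \<open>
  The walk \<open>M\<close> is opened at the item \<open>y\<close> and the cycle at its item \<open>x\<close>; exchanging their targets
  merges the two. Both items are then misplaced, and \<open>M'\<close> takes care of this by a detour through the
  single additional vertex \<open>v\<close>.
\<close>

lemma two_step_absorb_cycle:
  assumes M: "two_step c c' N M M'" "linked M M'"
    and Z: "simple_cycle Z" "set Z = arcs_between c c' K" "K \<inter> N = {}" "\<And>x. x \<in> K \<Longrightarrow> c x \<noteq> c' x"
    and disj: "ends Z \<inter> ends M = {}" and v: "v \<in> ends Z" "v \<notin> ends M'"
  obtains M1 M1' where "two_step c c' (N \<union> K) M1 M1'" "linked M1 M1'"
    "ends M1 \<subseteq> ends M \<union> ends Z" "ends M1' \<subseteq> ends M' \<union> ends M \<union> ends Z"
proof -
  obtain y L p b R L' b' R' where l: "M = L @ (p, y, b) # R" "M' = L' @ (b, y, b') # R'"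
    using M(2) by (auto simp: linked_def)
  obtain s t s' t' d where m: "walk s M t" "simple M" "walk s' M' t'" "simple M'"
    "set M = arcs_between c d N" "set M' = arcs_between d c' N"
    using M(1) unfolding two_step_def by blast
  \<comment> \<open>The rotation makes the arc into the fresh vertex \<open>v\<close> the last one;
    its item \<open>x\<close> is the one to be exchanged with \<open>y\<close>.\<close>
  obtain Z' where Z': "walk v Z' v" "simple Z'" "Z' \<noteq> []" "set Z' = set Z"
    using simple_cycle_rotate[OF Z(1) v(1)] by blast
  then obtain z e where "Z' = z @ [e]" by (metis rev_exhaust)
  then obtain u x where z: "Z' = z @ [(u, x, v)]" "walk v z u"
    using Z' by (cases e) auto
  have endsZ: "insert v (heads z) = ends Z" "insert u (tails z) = ends Z"
  proof -
    have "tails Z' = insert u (tails z)" "heads Z' = insert v (heads z)" using z(1) by auto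
    then show "insert v (heads z) = ends Z" "insert u (tails z) = ends Z"
      using simple_cycle_tails_heads[OF Z(1)] tails_heads_cong[OF Z'(4)] by simp_all
  qed
  \<comment> \<open>The first move drops \<open>y\<close> at \<open>v\<close> and \<open>x\<close>
    at \<open>b\<close>, and takes all other items of the cycle to their targets.\<close>
  define d' where
    "d' = (\<lambda>l. if l = y then v else if l = x then b else if l \<in> K then c' l else d l)"
  let ?M = "L @ (p, y, v) # z @ (u, x, b) # R" and ?M' = "L' @ (b, x, v) # (v, y, b') # R'"
  have yN: "y \<in> N" "c y = p" "d y = b" "c' y = b'" "p \<noteq> b" "b \<noteq> b'"
  proof -
    have "(p, y, b) \<in> set M" "(b, y, b') \<in> set M'" using l by auto
    then have "(p, y, b) \<in> arcs_between c d N" "(b, y, b') \<in> arcs_between d c' N"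
      using m(5,6) by auto
    then show "y \<in> N" "c y = p" "d y = b" "c' y = b'" "p \<noteq> b" "b \<noteq> b'"
      by (auto simp only: mem_arcs_between)
  qed
  have xK: "x \<in> K" "c x = u" "c' x = v" "u \<noteq> v"
  proof -
    have "(u, x, v) \<in> set Z" using z(1) Z'(4) by (metis in_set_conv_decomp)
    then have "(u, x, v) \<in> arcs_between c c' K" by (simp only: Z(2))
    then have "x \<in> K \<and> u = c x \<and> v = c' x \<and> u \<noteq> v" by (rule iffD1[OF mem_arcs_between])
    then show "x \<in> K" "c x = u" "c' x = v" "u \<noteq> v" by blast+
  qed
  have vb: "v \<noteq> b" "v \<noteq> p" "v \<noteq> b'" "u \<noteq> b"
  proof -
    have "p \<in> ends M" "b \<in> ends M" "b' \<in> ends M'" "u \<in> ends Z"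
      using l endsZ by auto
    then show "v \<noteq> b" "v \<noteq> p" "v \<noteq> b'" "u \<noteq> b" using disj v by blast+
  qed
  have setz: "set z = arcs_between c c' (K - {x})"
  proof -
    have "(u, x, v) \<notin> set z" using simple_distinct[OF Z'(2)] unfolding z(1) by simp
    moreover have "insert (u, x, v) (set z) = set Z" using z(1) Z'(4) by auto
    ultimately have "set z = arcs_between c c' K - {(u, x, v)}"
      unfolding Z(2) by blast
    then show ?thesis using xK by (simp add: arcs_between_remove)
  qed
  have setL: "set L \<union> set R = arcs_between c d (N - {y})"
  proof -
    have "(p, y, b) \<notin> set L \<union> set R" using simple_distinct[OF m(2)] unfolding l(1) by simp
    moreover have "insert (p, y, b) (set L \<union> set R) = set M" using l by simp
    ultimately have "set L \<union> set R = arcs_between c d N - {(p, y, b)}"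
      unfolding m(5) by blast
    then show ?thesis using yN by (simp add: arcs_between_remove)
  qed
  have setL': "set L' \<union> set R' = arcs_between d c' (N - {y})"
  proof -
    have "(b, y, b') \<notin> set L' \<union> set R'" using simple_distinct[OF m(4)] unfolding l(2) by simp
    moreover have "insert (b, y, b') (set L' \<union> set R') = set M'" using l by simp
    ultimately have "set L' \<union> set R' = arcs_between d c' N - {(b, y, b')}"
      unfolding m(6) by blast
    then show ?thesis using yN by (simp add: arcs_between_remove)
  qed
  have "set ?M = arcs_between c d' (N \<union> K)"
  proof -
    have "set ?M = (set L \<union> set R) \<union> set z \<union> {(p, y, v), (u, x, b)}" by auto
    moreover have "e \<in> (set L \<union> set R) \<union> set z \<union> {(p, y, v), (u, x, b)} \<longleftrightarrow>
        e \<in> arcs_between c d' (N \<union> K)" for e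
    proof (cases e)
      case (fields i l j)
      have "l \<in> K \<Longrightarrow> l \<notin> N" "l \<in> K \<Longrightarrow> c l \<noteq> c' l" "x \<notin> N" "y \<notin> K" "x \<noteq> y"
        using Z(3,4) yN xK by auto
      then show ?thesis
        unfolding setL setz fields using yN xK vb
        by (cases "l = y"; cases "l = x"; cases "l \<in> K") (simp_all add: d'_def, blast+)
    qed
    ultimately show ?thesis by (rule trans[OF _ set_eqI])
  qed
  moreover have "set ?M' = arcs_between d' c' (N \<union> K)"
  proof -
    have "set ?M' = (set L' \<union> set R') \<union> {(b, x, v), (v, y, b')}" by auto
    moreover have "e \<in> (set L' \<union> set R') \<union> {(b, x, v), (v, y, b')} \<longleftrightarrow>
        e \<in> arcs_between d' c' (N \<union> K)" for e
    proof (cases e)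
      case (fields i l j)
      have "l \<in> K \<Longrightarrow> l \<notin> N" "x \<notin> N" "y \<notin> K" "x \<noteq> y"
        using Z(3) yN xK by auto
      then show ?thesis
        unfolding setL' fields using yN xK vb
        by (cases "l = y"; cases "l = x"; cases "l \<in> K") (simp_all add: d'_def, blast+)
    qed
    ultimately show ?thesis by (rule trans[OF _ set_eqI])
  qed
  moreover have "walk s ?M t" "walk s' ?M' t'"
  proof -
    have "walk s L p" "walk b R t" "walk s' L' b" "walk b' R' t'" using m(1,3) l by auto
    then show "walk s ?M t" "walk s' ?M' t'" using z(2) by auto
  qed
  moreover have "simple ?M"
  proof -
    have "simple L" "simple R" "p \<notin> tails L" "p \<notin> tails R" "b \<notin> heads L" "b \<notin> heads R"
      "tails L \<inter> tails R = {}" "heads L \<inter> heads R = {}"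
      using m(2) unfolding l by auto
    moreover have "tails L \<union> tails R \<union> {p} \<subseteq> ends M" "heads L \<union> heads R \<union> {b} \<subseteq> ends M"
      unfolding l by auto
    then have "(tails L \<union> tails R \<union> {p}) \<inter> insert u (tails z) = {}"
      "(heads L \<union> heads R \<union> {b}) \<inter> insert v (heads z) = {}"
      using disj unfolding endsZ by blast+
    moreover have "simple z" "u \<notin> tails z" "v \<notin> heads z"
      using Z'(2) unfolding z by auto
    ultimately show ?thesis by (simp add: disjoint_iff) blast
  qed
  moreover have "simple ?M'"
    using m(4) v vb unfolding l by auto
  ultimately have "two_step c c' (N \<union> K) ?M ?M'"
    unfolding two_step_def by blast
  \<comment> \<open>The new item moved twice is \<open>x\<close>, from \<open>u\<close> over
    \<open>b\<close> to \<open>v\<close>, so the next cycle can be inserted at \<open>b\<close>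
    again.\<close>
  moreover have "linked ?M ?M'"
    unfolding linked_def
    by (intro exI[of _ x] exI[of _ "L @ (p, y, v) # z"] exI[of _ u] exI[of _ b] exI[of _ R]
        exI[of _ L'] exI[of _ v] exI[of _ "(v, y, b') # R'"]) simp
  moreover have "ends ?M \<subseteq> ends M \<union> ends Z" "ends ?M' \<subseteq> ends M' \<union> ends M \<union> ends Z"
    using l endsZ by auto
  ultimately show ?thesis using that by blast
qed

text \<open>The bounds on \<open>ends\<close> keep the induction going. A cycle disjoint from
  \<open>M\<close> and from the cycles absorbed so far is disjoint from \<open>M1\<close>, and its
  vertex outside \<open>M'\<close> is also outside \<open>M1'\<close>.\<close>

lemma two_step_absorb_cycles:
  assumes "finite \<Z>" and M: "two_step c c' N M M'" "linked M M'"
    and Z: "\<And>Z. Z \<in> \<Z> \<Longrightarrow> simple_cycle Z \<and> set Z \<subseteq> arcs_between c c' (- N)"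
    and disj: "\<And>Z Z'. Z \<in> \<Z> \<Longrightarrow> Z' \<in> \<Z> \<Longrightarrow> Z \<noteq> Z' \<Longrightarrow> ends Z \<inter> ends Z' = {}"
    and M_disj: "\<And>Z. Z \<in> \<Z> \<Longrightarrow> ends Z \<inter> ends M = {}"
    and M'_disj: "\<And>Z. Z \<in> \<Z> \<Longrightarrow> \<not> ends Z \<subseteq> ends M'"
  shows "\<exists>M1 M1'. two_step c c' (N \<union> (\<Union>Z\<in>\<Z>. labels Z)) M1 M1' \<and> linked M1 M1' \<and>
           ends M1 \<subseteq> ends M \<union> (\<Union>Z\<in>\<Z>. ends Z) \<and>
           ends M1' \<subseteq> ends M' \<union> ends M \<union> (\<Union>Z\<in>\<Z>. ends Z)"
  using assms(1) Z disj M_disj M'_disj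
proof (induction \<Z> rule: finite_induct)
  case empty
  then show ?case using M by auto
next
  case (insert Z \<Z>)
  let ?N = "N \<union> (\<Union>Z\<in>\<Z>. labels Z)"
  obtain M1 M1' where 1: "two_step c c' ?N M1 M1'" "linked M1 M1'"
    "ends M1 \<subseteq> ends M \<union> (\<Union>Z\<in>\<Z>. ends Z)"
    "ends M1' \<subseteq> ends M' \<union> ends M \<union> (\<Union>Z\<in>\<Z>. ends Z)"
  proof -
    have "\<exists>M1 M1'. two_step c c' ?N M1 M1' \<and> linked M1 M1' \<and>
        ends M1 \<subseteq> ends M \<union> (\<Union>Z\<in>\<Z>. ends Z) \<and>
        ends M1' \<subseteq> ends M' \<union> ends M \<union> (\<Union>Z\<in>\<Z>. ends Z)"
      by (rule insert.IH) (rule insert.prems; simp)+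
    then show ?thesis using that by blast
  qed
  have ZZ: "ends Z \<inter> ends Z' = {}" if "Z' \<in> \<Z>" for Z'
    using insert.prems(2)[of Z Z'] insert.hyps that by blast
  have sub: "set Z \<subseteq> arcs_between c c' (- N)" and cyc: "simple_cycle Z"
    using insert.prems(1)[of Z] by auto
  have setZ: "set Z = arcs_between c c' (labels Z)" by (rule set_arcs_between_labels[OF sub])
  have labN: "x \<notin> N \<and> c x \<noteq> c' x \<and> (c x, x, c' x) \<in> set Z" if "x \<in> labels Z" for x
    using arcs_between_labelsD[OF sub that] by simp
  \<comment> \<open>Since an item labels only one arc, a common label would give a common arc and
    hence a common vertex.\<close>
  have "labels Z \<inter> labels Z' = {}" if Z': "Z' \<in> \<Z>" for Z'
  proof (rule ccontr)
    assume "labels Z \<inter> labels Z' \<noteq> {}"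
    then obtain x where x: "x \<in> labels Z" "x \<in> labels Z'" by auto
    have "set Z' \<subseteq> arcs_between c c' (- N)" using insert.prems(1)[of Z'] Z' by blast
    then have "(c x, x, c' x) \<in> set Z'" using x(2) arcs_between_labelsD by metis
    then have "c x \<in> ends Z'" using arcs_mem(1) by fast
    moreover have "c x \<in> ends Z" using labN[OF x(1)] arcs_mem(1) by fast
    ultimately show False using ZZ[OF Z'] by blast
  qed
  then have "labels Z \<inter> ?N = {}" using labN by blast
  moreover have "ends Z \<inter> ends M1 = {}"
  proof -
    have "ends Z \<inter> (ends M \<union> (\<Union>Z\<in>\<Z>. ends Z)) = {}"
      using insert.prems(3)[of Z] ZZ by blast
    then show ?thesis using 1(3) by blast
  qed
  moreover obtain v where v: "v \<in> ends Z" "v \<notin> ends M'" using insert.prems(4)[of Z] by auto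
  moreover have "v \<notin> ends M1'"
  proof -
    have "v \<notin> ends M' \<union> ends M \<union> (\<Union>Z\<in>\<Z>. ends Z)"
      using v insert.prems(3)[of Z] ZZ by blast
    then show ?thesis using 1(4) by blast
  qed
  ultimately obtain M2 M2' where 2: "two_step c c' (?N \<union> labels Z) M2 M2'" "linked M2 M2'"
    "ends M2 \<subseteq> ends M1 \<union> ends Z" "ends M2' \<subseteq> ends M1' \<union> ends M1 \<union> ends Z"
    using two_step_absorb_cycle[OF 1(1,2) cyc setZ] labN by metis
  have "?N \<union> labels Z = N \<union> (\<Union>Z\<in>insert Z \<Z>. labels Z)" by auto
  then have "two_step c c' (N \<union> (\<Union>Z\<in>insert Z \<Z>. labels Z)) M2 M2'" using 2(1) by simp
  moreover have "ends M2 \<subseteq> ends M \<union> (\<Union>Z\<in>insert Z \<Z>. ends Z)"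
    using 1(3) 2(3) by blast
  moreover have "ends M2' \<subseteq> ends M' \<union> ends M \<union> (\<Union>Z\<in>insert Z \<Z>. ends Z)"
    using 1(3,4) 2(4) by blast
  ultimately show ?case using 2(2) by blast
qed

section \<open>A path and disjoint cycles\<close>

locale path_and_cycles =
  fixes c c' :: "'a \<Rightarrow> 'v" and N :: "'a set" and P :: "('v \<times> 'a \<times> 'v) list"
    and \<Y> :: "('v \<times> 'a \<times> 'v) list set" and s t :: 'v
  assumes moved: "\<And>x. x \<in> N \<Longrightarrow> c x \<noteq> c' x"
    and arcs_eq: "arcs_between c c' N = set P \<union> (\<Union>Z\<in>\<Y>. set Z)"
    and fin: "finite \<Y>"
    and cycle: "\<And>Z. Z \<in> \<Y> \<Longrightarrow> simple_cycle Z"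
    and cycles_disjoint: "\<And>Z Z'. Z \<in> \<Y> \<Longrightarrow> Z' \<in> \<Y> \<Longrightarrow> Z \<noteq> Z' \<Longrightarrow> ends Z \<inter> ends Z' = {}"
    and path: "walk s P t" "simple P" "s \<noteq> t"
    and path_cycle_arcs: "\<And>Z. Z \<in> \<Y> \<Longrightarrow> set P \<inter> set Z = {}"
begin

text \<open>The bound on \<open>ends M\<close> will ensure that the intermediate positions are
  numbers of clusters.\<close>

definition solvable :: bool where
  "solvable \<longleftrightarrow> (\<exists>M M'. two_step c c' N M M' \<and> M \<noteq> [] \<and> M' \<noteq> [] \<and>
     ends M \<subseteq> ends P \<union> (\<Union>Z\<in>\<Y>. ends Z))"

lemma cycle_arcs_disjoint: "Z \<in> \<Y> \<Longrightarrow> Z' \<in> \<Y> \<Longrightarrow> Z \<noteq> Z' \<Longrightarrow> set Z \<inter> set Z' = {}"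
proof (rule ccontr)
  assume Z: "Z \<in> \<Y>" "Z' \<in> \<Y>" "Z \<noteq> Z'" and "set Z \<inter> set Z' \<noteq> {}"
  then obtain i x j where "(i, x, j) \<in> set Z" "(i, x, j) \<in> set Z'" by auto
  then have "i \<in> tails Z" "i \<in> tails Z'" using arcs_mem(1) by metis+
  then show False using cycles_disjoint[OF Z] by blast
qed

lemma no_loop: "(i, x, j) \<in> set P \<union> (\<Union>Z\<in>\<Y>. set Z) \<Longrightarrow> i \<noteq> j"
  unfolding arcs_eq[symmetric] mem_arcs_between by (elim conjE)

lemma cycle_nonempty: "Z \<in> \<Y> \<Longrightarrow> ends Z \<noteq> {}"
  using cycle[of Z] by (auto simp: simple_cycle_def tails_def)

text \<open>The interface for the case constructions: they only treat the path and the cycles in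
  \<open>\<W>\<close>. The lists \<open>S\<close> and \<open>S'\<close> hold the arcs used unchanged
  in the first and second move. The last two hypotheses are the conditions for absorbing the cycles
  outside \<open>\<W>\<close>.\<close>

lemma solvableI:
  assumes W: "\<W> \<subseteq> \<Y>"
    and walks: "walk u M v" "simple M" "walk u' M' v'" "simple M'"
    and M: "set M = insert (p, y, b) (set S)" "set M' = insert (b, y, b') (set S')" "p \<noteq> b" "b \<noteq> b'"
    and S: "insert (p, y, b') (set S \<union> set S') = set P \<union> (\<Union>Z\<in>\<W>. set Z)" "distinct ((p, y, b') # S @ S')"
    and ends: "ends M \<subseteq> ends P \<union> (\<Union>Z\<in>\<W>. ends Z)"
    and disj: "\<And>Z. Z \<in> \<Y> - \<W> \<Longrightarrow> ends Z \<inter> ends M = {}"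
      "\<And>Z. Z \<in> \<Y> - \<W> \<Longrightarrow> \<not> ends Z \<subseteq> ends M'"
  shows solvable
proof -
  define N0 where "N0 = labels P \<union> (\<Union>Z\<in>\<W>. labels Z)"
  have P: "set P \<subseteq> arcs_between c c' N" and Z: "Z \<in> \<Y> \<Longrightarrow> set Z \<subseteq> arcs_between c c' N" for Z
    using arcs_eq by auto
  note labP = arcs_between_labelsD[OF P] and labZ = arcs_between_labelsD[OF Z]
  have N0: "N0 \<subseteq> N"
  proof
    fix x assume "x \<in> N0"
    then consider "x \<in> labels P" | Z where "Z \<in> \<Y>" "x \<in> labels Z" using W unfolding N0_def by blast
    then show "x \<in> N" using labP labZ by cases blast+
  qed
  have arcs0: "set P \<union> (\<Union>Z\<in>\<W>. set Z) = arcs_between c c' N0"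
  proof -
    have "arcs_between c c' N0 =
        arcs_between c c' (labels P) \<union> (\<Union>Z\<in>\<W>. arcs_between c c' (labels Z))"
      unfolding N0_def arcs_between_def by blast
    also have "arcs_between c c' (labels P) = set P"
      using set_arcs_between_labels[OF P] by simp
    also have "(\<Union>Z\<in>\<W>. arcs_between c c' (labels Z)) = (\<Union>Z\<in>\<W>. set Z)"
      using set_arcs_between_labels[OF Z] W by (intro SUP_cong refl) auto
    finally show ?thesis by simp
  qed
  have two: "two_step c c' N0 M M'"
  proof (rule two_stepI[OF walks M])
    show "set S \<union> set S' \<union> {(p, y, b')} = arcs_between c c' N0" using S(1) arcs0 by auto
    show "set S \<inter> set S' = {}" "(p, y, b') \<notin> set S \<union> set S'" using S(2) by auto
    show "c x \<noteq> c' x" if "x \<in> N0" for x using that N0 moved by blast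
  qed
  have link: "linked M M'"
  proof -
    have "(p, y, b) \<in> set M" "(b, y, b') \<in> set M'" using M by auto
    then obtain L R L' R' where "M = L @ (p, y, b) # R" "M' = L' @ (b, y, b') # R'"
      using split_list by metis
    then show ?thesis unfolding linked_def by blast
  qed
  have rest: "set Z \<subseteq> arcs_between c c' (- N0)" if "Z \<in> \<Y> - \<W>" for Z
  proof
    fix e assume e: "e \<in> set Z"
    obtain i x j where ix: "e = (i, x, j)" by (cases e)
    have mem: "e \<in> arcs_between c c' N" using e Z that by blast
    have "e \<notin> arcs_between c c' N0"
      unfolding arcs0[symmetric]
    proof
      assume "e \<in> set P \<union> (\<Union>Z\<in>\<W>. set Z)"
      then consider "e \<in> set P" | Z' where "Z' \<in> \<W>" "e \<in> set Z'" by blast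
      then show False
      proof cases
        case 1
        then show ?thesis using e path_cycle_arcs that by blast
      next
        case 2
        then have "Z' \<in> \<Y>" "Z \<in> \<Y>" "Z \<noteq> Z'" using W that by auto
        then show ?thesis using cycle_arcs_disjoint e 2 by blast
      qed
    qed
    then show "e \<in> arcs_between c c' (- N0)" using mem unfolding ix by auto
  qed
  have "\<exists>M1 M1'. two_step c c' (N0 \<union> (\<Union>Z\<in>\<Y> - \<W>. labels Z)) M1 M1' \<and> linked M1 M1' \<and>
           ends M1 \<subseteq> ends M \<union> (\<Union>Z\<in>\<Y> - \<W>. ends Z) \<and>
           ends M1' \<subseteq> ends M' \<union> ends M \<union> (\<Union>Z\<in>\<Y> - \<W>. ends Z)"
  proof (rule two_step_absorb_cycles[OF _ two link])
    show "finite (\<Y> - \<W>)" using fin by simp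
    show "simple_cycle Z \<and> set Z \<subseteq> arcs_between c c' (- N0)" if "Z \<in> \<Y> - \<W>" for Z
      using rest[OF that] cycle that by blast
    show "ends Z \<inter> ends Z' = {}" if "Z \<in> \<Y> - \<W>" "Z' \<in> \<Y> - \<W>" "Z \<noteq> Z'" for Z Z'
      using cycles_disjoint that by blast
  qed (use disj in blast)+
  moreover have "N0 \<union> (\<Union>Z\<in>\<Y> - \<W>. labels Z) = N"
  proof
    have "labels Z \<subseteq> N" if "Z \<in> \<Y>" for Z using labZ[OF that] by blast
    then show "N0 \<union> (\<Union>Z\<in>\<Y> - \<W>. labels Z) \<subseteq> N" using N0 by blast
    show "N \<subseteq> N0 \<union> (\<Union>Z\<in>\<Y> - \<W>. labels Z)"
    proof
      fix x assume "x \<in> N"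
      then have "(c x, x, c' x) \<in> set P \<union> (\<Union>Z\<in>\<Y>. set Z)"
        using moved unfolding arcs_eq[symmetric] by simp
      then have "x \<in> labels P \<union> (\<Union>Z\<in>\<Y>. labels Z)" using arcs_mem(3) by fast
      then show "x \<in> N0 \<union> (\<Union>Z\<in>\<Y> - \<W>. labels Z)" unfolding N0_def by blast
    qed
  qed
  ultimately obtain M1 M1' where 1: "two_step c c' N M1 M1'" "linked M1 M1'"
    "ends M1 \<subseteq> ends M \<union> (\<Union>Z\<in>\<Y> - \<W>. ends Z)" by auto
  have "M1 \<noteq> []" "M1' \<noteq> []" using 1(2) by (auto simp: linked_def)
  moreover have "ends M1 \<subseteq> ends P \<union> (\<Union>Z\<in>\<Y>. ends Z)" using 1(3) ends W by blast
  ultimately show ?thesis using 1(1) unfolding solvable_def by blast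
qed

section \<open>Opening a cycle at a vertex\<close>

lemma rotate:
  assumes "Z \<in> \<Y>" "w \<in> ends Z"
  obtains Z' where "walk w Z' w" "simple Z'" "Z' \<noteq> []" "set Z' = set Z" "tails Z' = ends Z" "heads Z' = ends Z"
proof -
  obtain Z' where "walk w Z' w" "simple Z'" "Z' \<noteq> []" "set Z' = set Z"
    using simple_cycle_rotate[OF cycle] assms by blast
  moreover from this have "tails Z' = ends Z" "heads Z' = ends Z"
    using simple_cycle_tails_heads[OF cycle[OF assms(1)]] tails_heads_cong[of Z' Z] by simp_all
  ultimately show ?thesis using that by blast
qed

text \<open>The cycle becomes a path \<open>z\<close> that starts at \<open>w\<close>, and the arc
  closing it is set aside. The constructions either divert the item of this arc or leave the arc to
  the other move.\<close>

lemma open_before: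
  assumes "Z \<in> \<Y>" "w \<in> ends Z"
  obtains z u x where "walk w z u" "set Z = insert (u, x, w) (set z)" "distinct ((u, x, w) # z)"
    "simple z" "insert u (tails z) \<subseteq> ends Z" "u \<notin> tails z" "insert w (heads z) \<subseteq> ends Z" "w \<notin> heads z"
    "u \<noteq> w"
proof -
  obtain Z' where Z': "walk w Z' w" "simple Z'" "Z' \<noteq> []" "set Z' = set Z" "tails Z' = ends Z"
    "heads Z' = ends Z"
    using rotate[OF assms] by blast
  obtain z e where "Z' = z @ [e]" using Z'(3) by (metis rev_exhaust)
  then obtain u x where z: "Z' = z @ [(u, x, w)]" using Z'(1) by (cases e) auto
  have "walk w z u" "simple z" "u \<notin> tails z" "w \<notin> heads z"
    "insert u (tails z) \<subseteq> ends Z" "insert w (heads z) \<subseteq> ends Z"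
    using Z'(1,2) equalityD1[OF Z'(5)] equalityD1[OF Z'(6)] unfolding z by simp_all
  moreover have setZ: "set Z = insert (u, x, w) (set z)" using Z'(4) unfolding z by auto
  moreover have "distinct ((u, x, w) # z)" using simple_distinct[OF Z'(2)] unfolding z by auto
  moreover have "u \<noteq> w" using no_loop[of u x w] setZ assms(1) by blast
  ultimately show ?thesis using that by blast
qed

text \<open>The mirror image: the arc leaving \<open>w\<close> is set aside, and \<open>z\<close>
  leads back to \<open>w\<close>.\<close>

lemma open_after:
  assumes "Z \<in> \<Y>" "w \<in> ends Z"
  obtains z a x where "walk a z w" "set Z = insert (w, x, a) (set z)" "distinct ((w, x, a) # z)"
    "simple z" "insert w (tails z) \<subseteq> ends Z" "w \<notin> tails z" "insert a (heads z) \<subseteq> ends Z" "a \<notin> heads z"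
    "a \<noteq> w"
proof -
  obtain Z' where Z': "walk w Z' w" "simple Z'" "Z' \<noteq> []" "set Z' = set Z" "tails Z' = ends Z"
    "heads Z' = ends Z"
    using rotate[OF assms] by blast
  obtain e z where "Z' = e # z" using Z'(3) by (metis list.exhaust)
  then obtain x a where z: "Z' = (w, x, a) # z" using Z'(1) by (cases e) auto
  have "walk a z w" "simple z" "w \<notin> tails z" "a \<notin> heads z"
    "insert w (tails z) \<subseteq> ends Z" "insert a (heads z) \<subseteq> ends Z"
    using Z'(1,2) equalityD1[OF Z'(5)] equalityD1[OF Z'(6)] unfolding z by simp_all
  moreover have setZ: "set Z = insert (w, x, a) (set z)" using Z'(4) unfolding z by auto
  moreover have "distinct ((w, x, a) # z)" using simple_distinct[OF Z'(2)] unfolding z by auto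
  moreover have "a \<noteq> w" using no_loop[of w x a] setZ assms(1) by blast
  ultimately show ?thesis using that by blast
qed

section \<open>Paths that meet at most one cycle\<close>

text \<open>
  At the vertex \<open>w\<close> the first move follows the path, but carries the item of the cycle instead of the
  item of the path.
\<close>

lemma solvable_meets_one_cycle_inner:
  assumes A: "A \<in> \<Y>" "w \<in> ends A" and P: "P = Q @ R" "walk s Q w" "walk w R t" "R \<noteq> []"
    and R: "heads R \<inter> ends A = {}"
    and rest: "\<And>Z. Z \<in> \<Y> - {A} \<Longrightarrow> ends Z \<inter> ends P = {}"
  shows solvable
proof -
  obtain g b R' where R': "R = (w, g, b) # R'" using P(3,4) by (cases R) auto
  obtain z q f where z: "walk q z w" "set A = insert (w, f, q) (set z)" "distinct ((w, f, q) # z)"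
    "simple z" "insert w (tails z) \<subseteq> ends A" "w \<notin> tails z" "insert q (heads z) \<subseteq> ends A" "q \<notin> heads z"
    "q \<noteq> w"
    by (rule open_after[OF A])
  \<comment> \<open>In the second move \<open>g\<close> makes up for its arc from \<open>w\<close>
    to \<open>b\<close>, then \<open>f\<close> goes from \<open>b\<close> to its proper target
    \<open>q\<close>, and the rest of \<open>A\<close> leads back to \<open>w\<close>. This cycle is
    simple because \<open>w\<close> is the last path vertex on \<open>A\<close>, so that
    \<open>b\<close> lies off \<open>A\<close>.\<close>
  let ?M = "Q @ (w, f, b) # R'" and ?M' = "(w, g, b) # (b, f, q) # z"
  have b: "b \<notin> ends A" using R R' by simp
  have wb: "w \<noteq> b" using b A by blast
  have qb: "b \<noteq> q" using b z(7) by blast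
  have dP: "distinct P" using path(2) by (rule simple_distinct)
  have PA: "set P \<inter> set A = {}" by (rule path_cycle_arcs[OF A(1)])
  have sP: "set P = insert (w, g, b) (set Q \<union> set R')" unfolding P R' by auto
  show ?thesis
  proof (rule solvableI[of "{A}" s ?M t w ?M' w w f b "Q @ R'" q "(w, g, b) # z"])
    show "{A} \<subseteq> \<Y>" using A by simp
    show "walk s ?M t" using P unfolding R' by auto
    show "simple ?M" using path(2) unfolding P R' by simp
    show "walk w ?M' w" using z(1) by simp
    have "w \<noteq> b" "b \<notin> tails z" "b \<notin> heads z" using b wb z(5,7) by blast+
    then show "simple ?M'" using z(4,6,8) qb by simp
    show "insert (w, f, q) (set (Q @ R') \<union> set ((w, g, b) # z)) = set P \<union> (\<Union>Z\<in>{A}. set Z)"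
      using z(2) sP by auto
    have "set Q \<inter> set z = {}" "set R' \<inter> set z = {}" "(w, g, b) \<notin> set z"
      "(w, f, q) \<notin> set Q" "(w, f, q) \<notin> set R'" "(w, f, q) \<noteq> (w, g, b)"
      using PA unfolding sP z(2) by blast+
    then show "distinct ((w, f, q) # (Q @ R') @ (w, g, b) # z)"
      using dP z(3) unfolding P R' by auto
    have e: "ends ?M \<subseteq> ends P" unfolding P R' by auto
    then show "ends ?M \<subseteq> ends P \<union> (\<Union>Z\<in>{A}. ends Z)" by blast
    show "ends Z \<inter> ends ?M = {}" if "Z \<in> \<Y> - {A}" for Z
      using rest[OF that] e by blast
    show "\<not> ends Z \<subseteq> ends ?M'" if "Z \<in> \<Y> - {A}" for Z
    proof -
      have "ends ?M' \<subseteq> ends P \<union> ends A" using z(5,7) unfolding P R' by auto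
      moreover have "ends Z \<inter> ends A = {}" using cycles_disjoint[of Z A] A that by blast
      moreover have "ends Z \<noteq> {}"
        using cycle_nonempty[of Z] that by blast
      ultimately show ?thesis using rest[OF that] by blast
    qed
  qed (use wb qb in auto)
qed

text \<open>Here no arc of the path leaves \<open>A\<close> for good, so no path item can be
  replaced by an item of \<open>A\<close>. Another cycle \<open>Z\<close> helps out: at the end of
  the path the item \<open>f\<close> of \<open>A\<close> overshoots to \<open>v\<close>, and the
  first move runs on through \<open>Z\<close>. The second move closes \<open>Z\<close> and takes
  \<open>f\<close> from \<open>v\<close> to its target on \<open>A\<close>.\<close>

lemma solvable_meets_one_cycle_end:
  assumes A: "A \<in> \<Y>" "t \<in> ends A"
    and rest: "\<And>Z. Z \<in> \<Y> - {A} \<Longrightarrow> ends Z \<inter> ends P = {}"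
    and Z: "Z \<in> \<Y>" "Z \<noteq> A"
  shows solvable
proof -
  obtain A' q f where a: "walk q A' t" "set A = insert (t, f, q) (set A')" "distinct ((t, f, q) # A')"
    "simple A'" "insert t (tails A') \<subseteq> ends A" "t \<notin> tails A'" "insert q (heads A') \<subseteq> ends A"
    "q \<notin> heads A'" "q \<noteq> t"
    by (rule open_after[OF A])
  have "ends Z \<noteq> {}" using Z cycle_nonempty by blast
  then obtain v where v: "v \<in> ends Z" by blast
  obtain z u x where z: "walk v z u" "set Z = insert (u, x, v) (set z)" "distinct ((u, x, v) # z)"
    "simple z" "insert u (tails z) \<subseteq> ends Z" "u \<notin> tails z" "insert v (heads z) \<subseteq> ends Z" "v \<notin> heads z"
    "u \<noteq> v"
    by (rule open_before[OF Z(1) v])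
  let ?M = "P @ (t, f, v) # z" and ?M' = "(u, x, v) # (v, f, q) # A'"
  have ZP: "ends Z \<inter> ends P = {}" using rest Z by blast
  have ZA: "ends Z \<inter> ends A = {}" using cycles_disjoint Z A by blast
  have tv: "t \<noteq> v" "v \<noteq> q" using ZA A v a(7) by blast+
  have dP: "distinct P" using path(2) by (rule simple_distinct)
  have PA: "set P \<inter> set A = {}" by (rule path_cycle_arcs[OF A(1)])
  have PZ: "set P \<inter> set Z = {}" by (rule path_cycle_arcs[OF Z(1)])
  have AZ: "set A \<inter> set Z = {}" using A Z by (intro cycle_arcs_disjoint) auto
  have tP: "t \<notin> tails P" by (rule simple_open_walk_target[OF path])
  show ?thesis
  proof (rule solvableI[of "{A, Z}" s ?M u u ?M' t t f v "P @ z" q "(u, x, v) # A'"])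
    show "{A, Z} \<subseteq> \<Y>" using A Z by simp
    show "walk s ?M u" using path z(1) by auto
    have "tails P \<inter> tails z = {}" "heads P \<inter> heads z = {}" "t \<notin> tails z" "v \<notin> heads P"
      using ZP ZA A z(5,7) v by blast+
    then show "simple ?M" using path(2) z(4,8) tP by simp
    show "walk u ?M' t" using a(1) by simp
    have "u \<notin> tails A'" "v \<notin> tails A'" "v \<notin> heads A'" using ZA a(5,7) z(5) v by blast+
    then show "simple ?M'" using a(4,8) z(9) tv by simp
    show "insert (t, f, q) (set (P @ z) \<union> set ((u, x, v) # A')) = set P \<union> (\<Union>Z\<in>{A, Z}. set Z)"
      using z(2) a(2) by auto
    have "set P \<inter> set z = {}" "set P \<inter> set A' = {}" "set z \<inter> set A' = {}" "(u, x, v) \<notin> set P"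
      "(u, x, v) \<notin> set A'" "(t, f, q) \<notin> set P" "(t, f, q) \<notin> set z" "(t, f, q) \<noteq> (u, x, v)"
      using PA PZ AZ unfolding z(2) a(2) by blast+
    then show "distinct ((t, f, q) # (P @ z) @ (u, x, v) # A')"
      using dP z(3) a(3) by auto
    have e: "ends ?M \<subseteq> ends P \<union> ends A \<union> ends Z" "ends ?M' \<subseteq> ends A \<union> ends Z"
      using z(5,7) a(5,7) v by auto
    then show "ends ?M \<subseteq> ends P \<union> (\<Union>Z\<in>{A, Z}. ends Z)" by blast
    fix Z' assume Z': "Z' \<in> \<Y> - {A, Z}"
    then have d: "ends Z' \<inter> ends A = {}" "ends Z' \<inter> ends Z = {}" "ends Z' \<inter> ends P = {}"
      using cycles_disjoint A Z rest by blast+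
    then show "ends Z' \<inter> ends ?M = {}" using e by blast
    have "ends Z' \<noteq> {}"
      using cycle_nonempty[of Z'] Z' by blast
    then show "\<not> ends Z' \<subseteq> ends ?M'" using e d by blast
  qed (use tv in auto)
qed

text \<open>When the path ends on the only cycle, there is no other cycle to jump to. Then the path
  and the cycle are themselves the two moves.\<close>

lemma solvable_single_cycle:
  assumes "\<Y> = {A}"
  shows solvable
proof -
  have PA: "set P \<inter> set A = {}" using assms by (intro path_cycle_arcs) simp
  have eq: "arcs_between c c' N = set P \<union> set A" using arcs_eq assms by simp
  define d where "d x = (if (c x, x, c' x) \<in> set P then c' x else c x)" for x
  have "set P = arcs_between c d N \<and> set A = arcs_between d c' N"
  proof -
    have iff: "(i, x, j) \<in> set P \<union> set A \<longleftrightarrow> x \<in> N \<and> i = c x \<and> j = c' x" for i x j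
      unfolding eq[symmetric] mem_arcs_between using moved by auto
    have "(i, x, j) \<in> set P \<longleftrightarrow> (i, x, j) \<in> arcs_between c d N" for i x j
      using iff[of i x j] moved[of x] unfolding d_def mem_arcs_between by auto
    moreover have "(i, x, j) \<in> set A \<longleftrightarrow> (i, x, j) \<in> arcs_between d c' N" for i x j
      using iff[of i x j] iff[of "c x" x "c' x"] PA moved[of x] unfolding d_def mem_arcs_between
      by auto
    ultimately show ?thesis by auto
  qed
  moreover obtain u where "walk u A u" "simple A" "A \<noteq> []"
    using cycle[of A] assms by (auto simp: simple_cycle_def)
  ultimately have "two_step c c' N P A" using path unfolding two_step_def by blast
  moreover have "P \<noteq> []" using path by auto
  ultimately show ?thesis using \<open>A \<noteq> []\<close> unfolding solvable_def by blast
qed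

text \<open>The last item \<open>y\<close> of the path is diverted to \<open>v\<close>, so that the
  first move continues through \<open>Z\<close>. The second move consists of two arcs: the missing
  arc of \<open>Z\<close> into \<open>v\<close>, and the way of \<open>y\<close> from
  \<open>v\<close> to \<open>t\<close>.\<close>

lemma solvable_disjoint:
  assumes Z: "Z \<in> \<Y>" and rest: "\<And>Z. Z \<in> \<Y> \<Longrightarrow> ends Z \<inter> ends P = {}"
  shows solvable
proof -
  have "P \<noteq> []" using path by auto
  then obtain Q e where "P = Q @ [e]" by (metis rev_exhaust)
  then obtain p y where P: "P = Q @ [(p, y, t)]" using path(1) by (cases e) auto
  have "ends Z \<noteq> {}" using Z cycle_nonempty by blast
  then obtain v where v: "v \<in> ends Z" by blast
  obtain z u x where z: "walk v z u" "set Z = insert (u, x, v) (set z)" "distinct ((u, x, v) # z)"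
    "simple z" "insert u (tails z) \<subseteq> ends Z" "u \<notin> tails z" "insert v (heads z) \<subseteq> ends Z" "v \<notin> heads z"
    "u \<noteq> v"
    by (rule open_before[OF Z(1) v])
  let ?M = "Q @ (p, y, v) # z" and ?M' = "[(u, x, v), (v, y, t)]"
  have ZP: "ends Z \<inter> ends P = {}" using rest Z by blast
  have "p \<in> ends P" "t \<in> ends P" unfolding P by auto
  then have pv: "p \<noteq> v" "v \<noteq> t" "t \<noteq> u" "p \<notin> tails z" using ZP v z(5) by blast+
  have dP: "distinct P" using path(2) by (rule simple_distinct)
  have PZ: "set P \<inter> set Z = {}" by (rule path_cycle_arcs[OF Z(1)])
  have sub: "tails Q \<subseteq> ends P" "heads Q \<subseteq> ends P" unfolding P by auto
  show ?thesis
  proof (rule solvableI[of "{Z}" s ?M u u ?M' t p y v "Q @ z" t "[(u, x, v)]"])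
    show "{Z} \<subseteq> \<Y>" using Z by simp
    show "walk s ?M u" using path(1) z(1) unfolding P by auto
    have "tails Q \<inter> tails z = {}" "heads Q \<inter> heads z = {}" "v \<notin> heads Q"
      using ZP sub z(5,7) v by blast+
    then show "simple ?M" using path(2) z(4,8) pv unfolding P by simp
    show "walk u ?M' t" by simp
    show "simple ?M'" using z(9) pv by simp
    show "insert (p, y, t) (set (Q @ z) \<union> set [(u, x, v)]) = set P \<union> (\<Union>Z\<in>{Z}. set Z)"
      using z(2) unfolding P by auto
    have "set Q \<inter> set z = {}" "(u, x, v) \<notin> set Q" "(p, y, t) \<notin> set z" "(p, y, t) \<noteq> (u, x, v)"
      using PZ unfolding z(2) P by auto
    then show "distinct ((p, y, t) # (Q @ z) @ [(u, x, v)])"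
      using dP z(3) unfolding P by auto
    have e: "ends ?M \<subseteq> ends P \<union> ends Z" "ends ?M' \<subseteq> ends P \<union> ends Z"
      using z(5,7) v unfolding P by auto
    then show "ends ?M \<subseteq> ends P \<union> (\<Union>Z\<in>{Z}. ends Z)" by blast
    fix Z' assume Z': "Z' \<in> \<Y> - {Z}"
    then have d: "ends Z' \<inter> ends Z = {}" "ends Z' \<inter> ends P = {}"
      using cycles_disjoint Z rest by blast+
    then show "ends Z' \<inter> ends ?M = {}" using e by blast
    have "ends Z' \<noteq> {}"
      using cycle_nonempty[of Z'] Z' by blast
    then show "\<not> ends Z' \<subseteq> ends ?M'" using e d by blast
  qed (use pv in auto)
qed

section \<open>Paths that meet at least two cycles\<close>

text \<open>
  The first move follows the path up to \<open>v\<close>, runs through \<open>A\<close>, jumps to \<open>B\<close>, and leaves \<open>B\<close> on the path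
  at \<open>w\<close>. The second move consists of the skipped part of the path and closes up through the jumping
  item.
\<close>

lemma solvable_last_met_once:
  assumes P: "P = P1 @ P2 @ P3" "walk s P1 v" "walk v P2 w" "walk w P3 t"
    and A: "A \<in> \<Y>" "v \<in> ends A" and B: "B \<in> \<Y>" "w \<in> ends B" and AB: "A \<noteq> B"
    and first: "\<And>Z. Z \<in> \<Y> \<Longrightarrow> tails P1 \<inter> ends Z = {}"
    and last: "\<And>Z. Z \<in> \<Y> \<Longrightarrow> heads P3 \<inter> ends Z = {}"
    and once: "ends P \<inter> ends B \<subseteq> {w}"
    and rest: "\<And>Z. Z \<in> \<Y> - {A, B} \<Longrightarrow> \<not> ends Z \<subseteq> ends P"
  shows solvable
proof -
  obtain A' p f where a: "walk v A' p" "set A = insert (p, f, v) (set A')"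
    "distinct ((p, f, v) # A')" "simple A'" "insert p (tails A') \<subseteq> ends A" "p \<notin> tails A'"
    "insert v (heads A') \<subseteq> ends A" "v \<notin> heads A'" "p \<noteq> v"
    by (rule open_before[OF A])
  obtain B' q h where b: "walk q B' w" "set B = insert (w, h, q) (set B')"
    "distinct ((w, h, q) # B')" "simple B'" "insert w (tails B') \<subseteq> ends B" "w \<notin> tails B'"
    "insert q (heads B') \<subseteq> ends B" "q \<notin> heads B'" "q \<noteq> w"
    by (rule open_after[OF B])
  let ?M = "P1 @ A' @ (p, f, q) # B' @ P3" and ?M' = "P2 @ [(w, h, q), (q, f, v)]"
  have disj: "ends A \<inter> ends B = {}" by (rule cycles_disjoint[OF A(1) B(1) AB])
  have vw: "v \<noteq> w" "p \<noteq> q" "q \<noteq> v" using disj A(2) B(2) a(5) b(7) by blast+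
  have P_simple: "simple P1" "simple P2" "simple P3" "tails P1 \<inter> tails P3 = {}"
    "heads P1 \<inter> heads P3 = {}"
    using path(2) unfolding P(1) by auto
  have sub: "ends P2 \<subseteq> ends P" "heads P1 \<subseteq> insert v (tails P1)" "tails P3 \<subseteq> insert w (heads P3)"
    using walk_ends_subset[OF P(2)] walk_ends_subset[OF P(4)] unfolding P(1) by auto
  \<comment> \<open>The second move visits \<open>q\<close> in addition to \<open>P2\<close>, so it
    is simple only if \<open>q\<close> lies off \<open>P2\<close>. This is the purpose of
    \<open>once\<close>.\<close>
  have qP: "q \<notin> ends P" using once b(7,9) by blast
  have wP2: "w \<notin> tails P2" by (rule simple_open_walk_target[OF P(3) P_simple(2) vw(1)])
  have vP2: "v \<notin> heads P2" by (rule simple_open_walk_source[OF P(3) P_simple(2) vw(1)])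
  have dP': "distinct P1" "distinct P2" "distinct P3" "set P1 \<inter> set P2 = {}"
    "set P1 \<inter> set P3 = {}" "set P2 \<inter> set P3 = {}"
    using simple_distinct[OF path(2)] unfolding P(1) by auto
  have PA: "set P \<inter> set A = {}" by (rule path_cycle_arcs[OF A(1)])
  have PB: "set P \<inter> set B = {}" by (rule path_cycle_arcs[OF B(1)])
  have AB': "set A \<inter> set B = {}" by (rule cycle_arcs_disjoint[OF A(1) B(1) AB])
  have sP: "set P = set P1 \<union> set P2 \<union> set P3" unfolding P(1) by auto
  show ?thesis
  proof (rule solvableI[of "{A, B}" s ?M t v ?M' v p f q "P1 @ A' @ B' @ P3" v "P2 @ [(w, h, q)]"])
    show "{A, B} \<subseteq> \<Y>" using A B by simp
    show "walk s ?M t" using P(2,4) a(1) b(1) by auto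
    show "walk v ?M' v" using P(3) by simp
    have 1: "tails P1 \<inter> ends A = {}" "tails P1 \<inter> ends B = {}" by (rule first, fact)+
    have 2: "heads P3 \<inter> ends A = {}" "heads P3 \<inter> ends B = {}" by (rule last, fact)+
    have "tails P1 \<inter> tails A' = {}" "p \<notin> tails P1" using 1 a(5) by blast+
    moreover have "tails P1 \<inter> tails B' = {}" using 1 b(5) by blast
    moreover have "tails A' \<inter> tails B' = {}" "p \<notin> tails B'" using disj a(5) b(5) by blast+
    moreover have "tails A' \<inter> tails P3 = {}" "p \<notin> tails P3"
      using sub(3) 2 disj B(2) a(5) by blast+
    moreover have "tails B' \<inter> tails P3 = {}" using sub(3) 2 b(5,6) by blast
    moreover have "heads P1 \<inter> heads A' = {}" using sub(2) 1 a(7,8) by blast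
    moreover have "heads P1 \<inter> heads B' = {}" "q \<notin> heads P1" using sub(2) 1 b(7) disj A(2) by blast+
    moreover have "heads A' \<inter> heads B' = {}" "q \<notin> heads A'" using disj a(7) b(7) by blast+
    moreover have "heads A' \<inter> heads P3 = {}" "heads B' \<inter> heads P3 = {}" "q \<notin> heads P3"
      using 2 a(7) b(7) by blast+
    ultimately show "simple ?M"
      using P_simple a(4,6) b(4,8) by (simp add: Int_Un_distrib Int_Un_distrib2)
    have "q \<notin> tails P2" "q \<notin> heads P2" using qP sub(1) by blast+
    then show "simple ?M'" using P_simple(2) wP2 vP2 b(9) vw by simp
    show "insert (p, f, v) (set (P1 @ A' @ B' @ P3) \<union> set (P2 @ [(w, h, q)])) =
        set P \<union> (\<Union>Z\<in>{A, B}. set Z)"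
      by (auto simp: a(2) b(2) sP)
    have "set P \<inter> set A' = {}" "set P \<inter> set B' = {}" "set A' \<inter> set B' = {}"
      "(w, h, q) \<notin> set P" "(p, f, v) \<notin> set P" "(w, h, q) \<notin> set A'" "(p, f, v) \<notin> set B'"
      "(p, f, v) \<noteq> (w, h, q)"
      using PA PB AB' unfolding a(2) b(2) by blast+
    then show "distinct ((p, f, v) # (P1 @ A' @ B' @ P3) @ P2 @ [(w, h, q)])"
      using dP' a(3) b(3) unfolding sP by (simp add: Int_Un_distrib Int_Un_distrib2 Int_commute)
    have e: "ends ?M' \<subseteq> ends P \<union> ends A \<union> ends B"
      unfolding append_Cons append_Nil tails_simps heads_simps using sub(1) A(2) b(5,7) by blast
    \<comment> \<open>The first move skips the path between \<open>v\<close> and \<open>w\<close>,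
      the only stretch where other cycles can meet it. Hence these cycles need not be disjoint from
      the path; it is enough that the path does not cover them.\<close>
    have e': "ends ?M \<subseteq> tails P1 \<union> heads P3 \<union> ends A \<union> ends B"
      unfolding tails_simps heads_simps using sub(2,3) a(5,7) b(5,7) A(2) B(2) by blast
    moreover have "tails P1 \<union> heads P3 \<subseteq> ends P" unfolding P(1) by auto
    ultimately show "ends ?M \<subseteq> ends P \<union> (\<Union>Z\<in>{A, B}. ends Z)" by blast
    fix Z assume Z: "Z \<in> \<Y> - {A, B}"
    then have d: "ends Z \<inter> ends A = {}" "ends Z \<inter> ends B = {}" "tails P1 \<inter> ends Z = {}"
      "heads P3 \<inter> ends Z = {}"
      using cycles_disjoint[of Z A] cycles_disjoint[of Z B] A(1) B(1) first[of Z] last[of Z]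
      by blast+
    then show "ends Z \<inter> ends ?M = {}" using e' by blast
    show "\<not> ends Z \<subseteq> ends ?M'" using e d rest[OF Z] by blast
  qed (use vw in auto)
qed

text \<open>
  The previous construction would pass twice through the successor of \<open>w\<close> in \<open>B\<close> if this vertex lies on
  the path. The construction below is the one obtained by reversing time and all arcs.
\<close>

lemma solvable_first_met_once:
  assumes P: "P = P1 @ P2 @ P3" "walk s P1 v" "walk v P2 w" "walk w P3 t"
    and A: "A \<in> \<Y>" "v \<in> ends A" and B: "B \<in> \<Y>" "w \<in> ends B" and AB: "A \<noteq> B"
    and first: "\<And>Z. Z \<in> \<Y> \<Longrightarrow> tails P1 \<inter> ends Z = {}"
    and last: "\<And>Z. Z \<in> \<Y> \<Longrightarrow> heads P3 \<inter> ends Z = {}"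
    and once: "ends P \<inter> ends A \<subseteq> {v}"
    and rest: "\<And>Z. Z \<in> \<Y> - {A, B} \<Longrightarrow> ends Z \<inter> ends P = {}"
  shows solvable
proof -
  obtain A' p f where a: "walk v A' p" "set A = insert (p, f, v) (set A')"
    "distinct ((p, f, v) # A')" "simple A'" "insert p (tails A') \<subseteq> ends A" "p \<notin> tails A'"
    "insert v (heads A') \<subseteq> ends A" "v \<notin> heads A'" "p \<noteq> v"
    by (rule open_before[OF A])
  obtain B' q h where b: "walk q B' w" "set B = insert (w, h, q) (set B')"
    "distinct ((w, h, q) # B')" "simple B'" "insert w (tails B') \<subseteq> ends B" "w \<notin> tails B'"
    "insert q (heads B') \<subseteq> ends B" "q \<notin> heads B'" "q \<noteq> w"
    by (rule open_after[OF B])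
  \<comment> \<open>The item broken up is now \<open>h\<close>: it leaves \<open>w\<close> for
    \<open>p\<close> instead of \<open>q\<close>. From \<open>p\<close> the item \<open>f\<close>
    goes to its target \<open>v\<close>, and \<open>P2\<close> closes the first move. The second
    move takes \<open>h\<close> from \<open>p\<close> to \<open>q\<close> on its way from
    \<open>A\<close> to \<open>B\<close>.\<close>
  let ?M = "[(w, h, p), (p, f, v)] @ P2" and ?M' = "P1 @ A' @ (p, h, q) # B' @ P3"
  have disj: "ends A \<inter> ends B = {}" by (rule cycles_disjoint[OF A(1) B(1) AB])
  have vw: "v \<noteq> w" "p \<noteq> q" "w \<noteq> p" using disj A(2) B(2) a(5) b(7) by blast+
  have P_simple: "simple P1" "simple P2" "simple P3" "tails P1 \<inter> tails P3 = {}"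
    "heads P1 \<inter> heads P3 = {}"
    using path(2) unfolding P(1) by auto
  have sub: "ends P2 \<subseteq> ends P" "heads P1 \<subseteq> insert v (tails P1)" "tails P3 \<subseteq> insert w (heads P3)"
    using walk_ends_subset[OF P(2)] walk_ends_subset[OF P(4)] unfolding P(1) by auto
  have pP: "p \<notin> ends P" using once a(5,9) by blast
  have wP2: "w \<notin> tails P2" by (rule simple_open_walk_target[OF P(3) P_simple(2) vw(1)])
  have vP2: "v \<notin> heads P2" by (rule simple_open_walk_source[OF P(3) P_simple(2) vw(1)])
  have "P2 \<noteq> []" using P(3) vw(1) by auto
  then have vwP: "v \<in> ends P2" "w \<in> ends P2"
    using walk_in_tails[OF P(3)] walk_in_heads[OF P(3)] by blast+
  have dP': "distinct P1" "distinct P2" "distinct P3" "set P1 \<inter> set P2 = {}"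
    "set P1 \<inter> set P3 = {}" "set P2 \<inter> set P3 = {}"
    using simple_distinct[OF path(2)] unfolding P(1) by auto
  have PA: "set P \<inter> set A = {}" by (rule path_cycle_arcs[OF A(1)])
  have PB: "set P \<inter> set B = {}" by (rule path_cycle_arcs[OF B(1)])
  have AB': "set A \<inter> set B = {}" by (rule cycle_arcs_disjoint[OF A(1) B(1) AB])
  have sP: "set P = set P1 \<union> set P2 \<union> set P3" unfolding P(1) by auto
  show ?thesis
  proof (rule solvableI[of "{A, B}" w ?M w s ?M' t w h p "(p, f, v) # P2" q "P1 @ A' @ B' @ P3"])
    show "{A, B} \<subseteq> \<Y>" using A B by simp
    show "walk s ?M' t" using P(2,4) a(1) b(1) by auto
    show "walk w ?M w" using P(3) by simp
    have 1: "tails P1 \<inter> ends A = {}" "tails P1 \<inter> ends B = {}" by (rule first, fact)+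
    have 2: "heads P3 \<inter> ends A = {}" "heads P3 \<inter> ends B = {}" by (rule last, fact)+
    have "tails P1 \<inter> tails A' = {}" "p \<notin> tails P1" using 1 a(5) by blast+
    moreover have "tails P1 \<inter> tails B' = {}" using 1 b(5) by blast
    moreover have "tails A' \<inter> tails B' = {}" "p \<notin> tails B'" using disj a(5) b(5) by blast+
    moreover have "tails A' \<inter> tails P3 = {}" "p \<notin> tails P3"
      using sub(3) 2 disj B(2) a(5) by blast+
    moreover have "tails B' \<inter> tails P3 = {}" using sub(3) 2 b(5,6) by blast
    moreover have "heads P1 \<inter> heads A' = {}" using sub(2) 1 a(7,8) by blast
    moreover have "heads P1 \<inter> heads B' = {}" "q \<notin> heads P1" using sub(2) 1 b(7) disj A(2) by blast+
    moreover have "heads A' \<inter> heads B' = {}" "q \<notin> heads A'" using disj a(7) b(7) by blast+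
    moreover have "heads A' \<inter> heads P3 = {}" "heads B' \<inter> heads P3 = {}" "q \<notin> heads P3"
      using 2 a(7) b(7) by blast+
    ultimately show "simple ?M'"
      using P_simple a(4,6) b(4,8) by (simp add: Int_Un_distrib Int_Un_distrib2)
    have "p \<notin> tails P2" "p \<notin> heads P2" using pP sub(1) by blast+
    then show "simple ?M" using P_simple(2) wP2 vP2 a(9) vw by simp
    show "insert (w, h, q) (set ((p, f, v) # P2) \<union> set (P1 @ A' @ B' @ P3)) =
        set P \<union> (\<Union>Z\<in>{A, B}. set Z)"
      by (auto simp: a(2) b(2) sP)
    have "set P \<inter> set A' = {}" "set P \<inter> set B' = {}" "set A' \<inter> set B' = {}"
      "(w, h, q) \<notin> set P" "(p, f, v) \<notin> set P" "(w, h, q) \<notin> set A'" "(p, f, v) \<notin> set B'"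
      "(w, h, q) \<noteq> (p, f, v)"
      using PA PB AB' unfolding a(2) b(2) by blast+
    then show "distinct ((w, h, q) # ((p, f, v) # P2) @ P1 @ A' @ B' @ P3)"
      using dP' a(3) b(3) unfolding sP by (simp add: Int_Un_distrib Int_Un_distrib2 Int_commute)
    have "ends P1 \<subseteq> ends P" "ends P3 \<subseteq> ends P" unfolding P(1) by auto
    then have e': "ends ?M' \<subseteq> ends P \<union> ends A \<union> ends B"
      unfolding tails_simps heads_simps using a(5,7) b(5,7) by blast
    \<comment> \<open>As \<open>P2\<close> belongs to the first move here, the remaining cycles must
      avoid the path altogether.\<close>
    have e: "ends ?M \<subseteq> ends P \<union> ends A"
      unfolding append_Cons append_Nil tails_simps heads_simps using sub(1) vwP a(5) A(2) by blast
    then show "ends ?M \<subseteq> ends P \<union> (\<Union>Z\<in>{A, B}. ends Z)" by blast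
    fix Z assume Z: "Z \<in> \<Y> - {A, B}"
    then have d: "ends Z \<inter> ends A = {}" "ends Z \<inter> ends B = {}" "ends Z \<inter> ends P = {}"
      using cycles_disjoint[of Z A] cycles_disjoint[of Z B] A(1) B(1) rest[of Z] by blast+
    then show "ends Z \<inter> ends ?M = {}" using e by blast
    show "\<not> ends Z \<subseteq> ends ?M'" using e' d cycle_nonempty[of Z] Z by blast
  qed (use vw in auto)
qed

text \<open>The path meets \<open>A\<close> at \<open>v\<close>, then \<open>B\<close> at
  \<open>m\<close>, then \<open>A\<close> at \<open>w\<close>. The first move leaves the path at
  \<open>v\<close> and follows \<open>A\<close> almost to \<open>w\<close>, but the item
  \<open>f\<close> due there jumps to \<open>q\<close> on \<open>B\<close>; the rest of
  \<open>B\<close> leads to \<open>m\<close>, where the path is resumed. The second move is a cycle: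
  the skipped part of the path from \<open>v\<close> to \<open>m\<close>, the arc of
  \<open>B\<close> from \<open>m\<close> to \<open>q\<close>, the item \<open>f\<close> from
  \<open>q\<close> to \<open>w\<close>, and the rest of \<open>A\<close> back to
  \<open>v\<close>.\<close>

lemma solvable_first_last_same:
  assumes P: "P = P1 @ P2 @ P3 @ P4" "walk s P1 v" "walk v P2 m" "walk m P3 w" "walk w P4 t"
    and A: "A \<in> \<Y>" "v \<in> ends A" "w \<in> ends A" and vw: "v \<noteq> w"
    and B: "B \<in> \<Y>" "m \<in> ends B" and AB: "A \<noteq> B"
    and PA: "ends P \<inter> ends A \<subseteq> {v, w}" and PB: "ends P \<inter> ends B \<subseteq> {m}"
    and first: "\<And>Z. Z \<in> \<Y> \<Longrightarrow> tails P1 \<inter> ends Z = {}"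
    and last: "\<And>Z. Z \<in> \<Y> \<Longrightarrow> heads P4 \<inter> ends Z = {}"
    and rest: "\<And>Z. Z \<in> \<Y> - {A, B} \<Longrightarrow> ends Z \<inter> ends P = {}"
  shows solvable
proof -
  obtain A0 where A0: "walk v A0 v" "simple A0" "set A0 = set A" "tails A0 = ends A" "heads A0 = ends A"
    by (rule rotate[OF A(1,2)])
  have "w \<in> insert v (heads A0)" using A(3) A0(5) by simp
  then obtain A1 A2 where A12: "A0 = A1 @ A2" "walk v A1 w" "walk w A2 v"
    by (rule walk_split_vertex[OF A0(1)])
  have "A1 \<noteq> []" using A12(2) vw by auto
  then obtain A1' e where "A1 = A1' @ [e]" by (metis rev_exhaust)
  then obtain p f where A1: "A1 = A1' @ [(p, f, w)]" "walk v A1' p" using A12(2) by (cases e) auto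
  have sA: "simple A1" "simple A2" "tails A1 \<inter> tails A2 = {}" "heads A1 \<inter> heads A2 = {}"
    using A0(2) unfolding A12(1) by auto
  have subA: "tails A1 \<subseteq> ends A" "tails A2 \<subseteq> ends A" "heads A1 \<subseteq> ends A" "heads A2 \<subseteq> ends A"
    using A0(4,5) unfolding A12(1) by auto
  have wA1: "w \<notin> tails A1" by (rule simple_open_walk_target[OF A12(2) sA(1) vw])
  have vA1: "v \<notin> heads A1" by (rule simple_open_walk_source[OF A12(2) sA(1) vw])
  have vA2: "v \<notin> tails A2" by (rule simple_open_walk_target[OF A12(3) sA(2) vw[symmetric]])
  have wA2: "w \<notin> heads A2" by (rule simple_open_walk_source[OF A12(3) sA(2) vw[symmetric]])
  have pA: "p \<in> ends A" "p \<notin> tails A1'" "simple A1'" "w \<notin> heads A1'" "tails A1' \<subseteq> tails A1"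
    "heads A1' \<subseteq> heads A1" "p \<in> tails A1" "w \<in> heads A1"
    using subA sA(1) unfolding A1(1) by auto
  have setA: "set A = insert (p, f, w) (set A1' \<union> set A2)"
    using A0(3) unfolding A12(1) A1(1) by auto
  have dA: "distinct A1'" "distinct A2" "set A1' \<inter> set A2 = {}" "(p, f, w) \<notin> set A1'" "(p, f, w) \<notin> set A2"
    using simple_distinct[OF A0(2)] unfolding A12(1) A1(1) by auto
  obtain B' q h where b: "walk q B' m" "set B = insert (m, h, q) (set B')"
    "distinct ((m, h, q) # B')" "simple B'" "insert m (tails B') \<subseteq> ends B" "m \<notin> tails B'"
    "insert q (heads B') \<subseteq> ends B" "q \<notin> heads B'" "q \<noteq> m"
    by (rule open_after[OF B])
  let ?M = "P1 @ A1' @ (p, f, q) # B' @ P3 @ P4" and ?M' = "P2 @ [(m, h, q), (q, f, w)] @ A2"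
  have disj: "ends A \<inter> ends B = {}" by (rule cycles_disjoint[OF A(1) B(1) AB])
  have neq: "v \<noteq> m" "w \<noteq> m" "p \<noteq> q" "q \<noteq> w" using disj A(2,3) B(2) pA(1) b(7) by blast+
  have ne: "P2 \<noteq> []" "P3 \<noteq> []" using P(3,4) neq by auto
  have P_simple: "simple P1" "simple P2" "simple P3" "simple P4"
    "tails P1 \<inter> tails P2 = {}" "tails P1 \<inter> tails P3 = {}" "tails P1 \<inter> tails P4 = {}"
    "tails P2 \<inter> tails P3 = {}" "tails P2 \<inter> tails P4 = {}" "tails P3 \<inter> tails P4 = {}"
    "heads P1 \<inter> heads P2 = {}" "heads P1 \<inter> heads P3 = {}" "heads P1 \<inter> heads P4 = {}"
    "heads P2 \<inter> heads P3 = {}" "heads P2 \<inter> heads P4 = {}" "heads P3 \<inter> heads P4 = {}"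
    using path(2) unfolding P(1) by auto
  have sub: "ends P1 \<subseteq> ends P" "ends P2 \<subseteq> ends P" "ends P3 \<subseteq> ends P" "ends P4 \<subseteq> ends P"
    unfolding P(1) by auto
  have mem: "v \<in> tails P2" "m \<in> heads P2" "m \<in> tails P3" "w \<in> heads P3"
    using walk_in_tails[OF P(3)] walk_in_heads[OF P(3)] walk_in_tails[OF P(4)] walk_in_heads[OF P(4)] ne
    by blast+
  have wP: "w \<notin> tails P2" "w \<notin> tails P3"
  proof -
    have "walk v (P2 @ P3) w" using P(3,4) by auto
    moreover have "simple (P2 @ P3)" using P_simple by simp
    ultimately have "w \<notin> tails (P2 @ P3)" using vw by (rule simple_open_walk_target)
    then show "w \<notin> tails P2" "w \<notin> tails P3" by auto
  qed
  have vP: "v \<notin> heads P2" "v \<notin> heads P3"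
  proof -
    have "walk v (P2 @ P3) w" using P(3,4) by auto
    moreover have "simple (P2 @ P3)" using P_simple by simp
    ultimately have "v \<notin> heads (P2 @ P3)" using vw by (rule simple_open_walk_source)
    then show "v \<notin> heads P2" "v \<notin> heads P3" by auto
  qed
  have mP2: "m \<notin> tails P2" using mem(3) P_simple by blast
  have qP: "q \<notin> ends P" using PB b(7,9) by blast
  have ends_P1: "heads P1 \<subseteq> insert v (tails P1)" using walk_ends_subset[OF P(2)] by blast
  have ends_P4: "tails P4 \<subseteq> insert w (heads P4)" using walk_ends_subset[OF P(5)] by blast
  have dP: "distinct P1" "distinct P2" "distinct P3" "distinct P4"
    "set P1 \<inter> set P2 = {}" "set P1 \<inter> set P3 = {}" "set P1 \<inter> set P4 = {}"
    "set P2 \<inter> set P3 = {}" "set P2 \<inter> set P4 = {}" "set P3 \<inter> set P4 = {}"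
    using simple_distinct[OF path(2)] unfolding P(1) by auto
  have sP: "set P = set P1 \<union> set P2 \<union> set P3 \<union> set P4" unfolding P(1) by auto
  have arcs_disjoint: "set P \<inter> set A = {}" "set P \<inter> set B = {}" "set A \<inter> set B = {}"
    by (rule path_cycle_arcs[OF A(1)] path_cycle_arcs[OF B(1)] cycle_arcs_disjoint[OF A(1) B(1) AB])+
  show ?thesis
  proof (rule solvableI[of "{A, B}" s ?M t v ?M' v p f q "P1 @ A1' @ B' @ P3 @ P4" w
        "P2 @ [(m, h, q)] @ A2"])
    show "{A, B} \<subseteq> \<Y>" using A B by simp
    show "walk s ?M t" using P(2,4,5) A1(2) b(1) by auto
    show "walk v ?M' v" using P(3) A12(3) by auto
    have 1: "tails P1 \<inter> ends A = {}" "tails P1 \<inter> ends B = {}" by (rule first, fact)+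
    have 2: "heads P4 \<inter> ends A = {}" "heads P4 \<inter> ends B = {}" by (rule last, fact)+
    \<comment> \<open>The resumed path touches \<open>A\<close> only when \<open>P3\<close> arrives
      at \<open>w\<close>. This vertex is still free in the first move, because \<open>A1'\<close>
      stops just before it.\<close>
    have "tails P3 \<inter> ends A \<subseteq> {v, w}" using PA sub(3) by blast
    then have tP3: "tails P3 \<inter> ends A = {}" using wP(2) mem(1) P_simple(8) by blast
    have "heads P3 \<inter> ends B \<subseteq> {m}" using PB sub(3) by blast
    then have hP3: "heads P3 \<inter> ends B = {}" using mem(2) P_simple(14) by blast
    have tA1: "tails A1' \<subseteq> ends A" "heads A1' \<subseteq> ends A" "w \<notin> tails A1'" "v \<notin> heads A1'" "p \<noteq> w"
      using pA(5,6,7) subA(1,3) wA1 vA1 by blast+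
    have "tails P1 \<inter> tails A1' = {}" "p \<notin> tails P1" "tails P1 \<inter> tails B' = {}"
      using 1 tA1(1) pA(1) b(5) by blast+
    moreover have "tails A1' \<inter> tails B' = {}" "p \<notin> tails B'"
      using disj tA1(1) pA(1) b(5) by blast+
    moreover have "tails A1' \<inter> tails P3 = {}" "p \<notin> tails P3"
      using tP3 tA1(1) pA(1) by blast+
    moreover have "tails A1' \<inter> tails P4 = {}" "p \<notin> tails P4"
      using ends_P4 2(1) tA1 pA(1) by blast+
    moreover have "tails B' \<inter> tails P3 = {}" "tails B' \<inter> tails P4 = {}"
      using PB b(5,6) sub(3,4) by blast+
    moreover have "heads P1 \<inter> heads A1' = {}" using ends_P1 1(1) tA1(2,4) by blast
    moreover have "heads P1 \<inter> heads B' = {}" "q \<notin> heads P1"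
      using ends_P1 1(2) b(7) disj A(2) by blast+
    moreover have "heads A1' \<inter> heads B' = {}" "q \<notin> heads A1'" using disj tA1(2) b(7) by blast+
    moreover have "heads A1' \<inter> heads P3 = {}"
      using PA sub(3) tA1(2) vP(2) pA(4) by blast
    moreover have "heads A1' \<inter> heads P4 = {}" "heads B' \<inter> heads P4 = {}" "q \<notin> heads P4"
      using 2 tA1(2) b(7) by blast+
    moreover have "heads B' \<inter> heads P3 = {}" "q \<notin> heads P3" using hP3 b(7) by blast+
    ultimately show "simple ?M"
      using P_simple pA(2,3) b(4,8) by (simp add: Int_Un_distrib Int_Un_distrib2)
    have "q \<notin> tails P2" "q \<notin> heads P2" using qP sub(2) by blast+
    moreover have "tails P2 \<inter> tails A2 = {}" using PA sub(2) subA(2) vA2 wP(1) by blast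
    moreover have "heads P2 \<inter> heads A2 = {}" using PA sub(2) subA(4) wA2 vP(1) by blast
    moreover have "m \<notin> tails A2" "q \<notin> tails A2" "q \<notin> heads A2"
      using disj subA(2,4) B(2) b(7) by blast+
    moreover have "w \<notin> heads P2" using mem(4) P_simple(14) by blast
    ultimately show "simple ?M'"
      using P_simple(2) sA(2) mP2 wA2 b(9) neq by (simp add: Int_Un_distrib Int_Un_distrib2)
    show "insert (p, f, w) (set (P1 @ A1' @ B' @ P3 @ P4) \<union> set (P2 @ [(m, h, q)] @ A2)) =
        set P \<union> (\<Union>Z\<in>{A, B}. set Z)"
      by (auto simp: setA b(2) sP)
    have "set P \<inter> set A1' = {}" "set P \<inter> set A2 = {}" "set P \<inter> set B' = {}"
      "set A1' \<inter> set B' = {}" "set A2 \<inter> set B' = {}" "(m, h, q) \<notin> set P" "(p, f, w) \<notin> set P"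
      "(m, h, q) \<notin> set A1'" "(m, h, q) \<notin> set A2" "(p, f, w) \<notin> set B'" "(p, f, w) \<noteq> (m, h, q)"
      using arcs_disjoint unfolding setA b(2) by blast+
    then show "distinct ((p, f, w) # (P1 @ A1' @ B' @ P3 @ P4) @ P2 @ [(m, h, q)] @ A2)"
      using dP dA b(3) unfolding sP by (simp add: Int_Un_distrib Int_Un_distrib2 Int_commute)
    have e: "ends ?M \<subseteq> ends P \<union> ends A \<union> ends B"
      unfolding append_Cons append_Nil tails_simps heads_simps
      using sub tA1(1,2) pA(1) b(5,7) by blast
    then show "ends ?M \<subseteq> ends P \<union> (\<Union>Z\<in>{A, B}. ends Z)" by blast
    have e': "ends ?M' \<subseteq> ends P \<union> ends A \<union> ends B"
      unfolding append_Cons append_Nil tails_simps heads_simps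
      using sub(2) subA(2,4) A(3) b(5,7) by blast
    fix Z assume Z: "Z \<in> \<Y> - {A, B}"
    then have d: "ends Z \<inter> ends A = {}" "ends Z \<inter> ends B = {}" "ends Z \<inter> ends P = {}"
      using cycles_disjoint[of Z A] cycles_disjoint[of Z B] A(1) B(1) rest[of Z] by blast+
    then show "ends Z \<inter> ends ?M = {}" using e by blast
    show "\<not> ends Z \<subseteq> ends ?M'" using e' d cycle_nonempty[of Z] Z by blast
  qed (use neq in auto)
qed

text \<open>Let \<open>v\<close> and \<open>w\<close> be the first and the last shared vertex, on
  the cycles \<open>A\<close> and \<open>B\<close>. If \<open>A\<close> and \<open>B\<close> differ,
  only one shared vertex may be left over. Either it is not on \<open>B\<close>, or it is on
  \<open>B\<close>, and then \<open>A\<close> is met only at \<open>v\<close> and no third cycle is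
  met at all. If \<open>A\<close> and \<open>B\<close> coincide, a vertex on another cycle lies
  between \<open>v\<close> and \<open>w\<close> and is the only further shared vertex. Otherwise
  \<open>A\<close> alone is met, and it matters whether the path goes on after
  \<open>w\<close>.\<close>

lemma solvable_at_most_three:
  assumes ne: "\<Y> \<noteq> {}" and three: "card (ends P \<inter> (\<Union>Z\<in>\<Y>. ends Z)) \<le> 3"
  shows solvable
proof -
  define V where "V = (\<Union>Z\<in>\<Y>. ends Z)"
  have "finite (ends P \<inter> V)" by (simp add: tails_def heads_def)
  have W: "x \<in> {a, b, d}"
    if "x \<in> ends P \<inter> V" "a \<in> ends P \<inter> V" "b \<in> ends P \<inter> V" "d \<in> ends P \<inter> V"
      "a \<noteq> b" "a \<noteq> d" "b \<noteq> d" for x a b d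
  proof -
    have "card {a, b, d} = 3" using that by simp
    then have "{a, b, d} = ends P \<inter> V"
      using that three \<open>finite (ends P \<inter> V)\<close> by (intro card_seteq) (auto simp: V_def)
    then show ?thesis using that(1) by blast
  qed
  have endsV: "ends Z \<subseteq> V" if "Z \<in> \<Y>" for Z using that unfolding V_def by blast
  have uniq: "Z = Z'" if "Z \<in> \<Y>" "Z' \<in> \<Y>" "x \<in> ends Z" "x \<in> ends Z'" for Z Z' x
    using cycles_disjoint[of Z Z'] that by blast
  show ?thesis
  proof (cases "ends P \<inter> V = {}")
    case True
    obtain Z where Z: "Z \<in> \<Y>" using ne by blast
    have "ends Z \<inter> ends P = {}" if "Z \<in> \<Y>" for Z using endsV[OF that] True by blast
    then show ?thesis by (rule solvable_disjoint[OF Z])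
  next
    case False
    then have "insert s (heads P) \<inter> V \<noteq> {}" using walk_ends_subset(1)[OF path(1)] by blast
    then obtain P1 Q v where 1: "P = P1 @ Q" "walk s P1 v" "walk v Q t" "v \<in> V" "tails P1 \<inter> V = {}"
      by (rule walk_split_first[OF path(1)])
    then have "insert v (heads Q) \<inter> V \<noteq> {}" by blast
    then obtain P2 P3 w where 2: "Q = P2 @ P3" "walk v P2 w" "walk w P3 t" "w \<in> V" "heads P3 \<inter> V = {}"
      by (rule walk_split_last[OF 1(3)])
    have P: "P = P1 @ P2 @ P3" using 1(1) 2(1) by simp
    obtain A where A: "A \<in> \<Y>" "v \<in> ends A" using 1(4) unfolding V_def by blast
    obtain B where B: "B \<in> \<Y>" "w \<in> ends B" using 2(4) unfolding V_def by blast
    have first: "tails P1 \<inter> ends Z = {}" if "Z \<in> \<Y>" for Z using endsV[OF that] 1(5) by blast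
    have last: "heads P3 \<inter> ends Z = {}" if "Z \<in> \<Y>" for Z using endsV[OF that] 2(5) by blast
    have "P \<noteq> []" using path by auto
    then have st: "s \<in> ends P" "t \<in> ends P"
      using walk_in_tails[OF path(1)] walk_in_heads[OF path(1)] by blast+
    have sub: "ends P1 \<subseteq> ends P" "ends P2 \<subseteq> ends P" "ends P3 \<subseteq> ends P" unfolding P by auto
    have vP: "v \<in> ends P" using equalityD1[OF walk_tails_heads[OF 1(2)]] sub(1) st(1) by blast
    have wP: "w \<in> ends P" using equalityD1[OF walk_tails_heads[OF 2(2)]] sub(2) vP by blast
    have vW: "v \<in> ends P \<inter> V" "w \<in> ends P \<inter> V" using vP wP 1(4) 2(4) by auto
    show ?thesis
    proof (cases "A = B")
      case AB: False
      have vw: "v \<noteq> w" using uniq[OF A(1) B(1) A(2)] B(2) AB by blast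
      show ?thesis
      proof (cases "ends P \<inter> ends B \<subseteq> {w}")
        case True
        \<comment> \<open>There are no loops, so \<open>Z\<close> has two vertices. If both were on
          the path, there would be four shared vertices together with \<open>v\<close> and
          \<open>w\<close>.\<close>
        have "\<not> ends Z \<subseteq> ends P" if Z: "Z \<in> \<Y> - {A, B}" for Z
        proof
          assume ZP: "ends Z \<subseteq> ends P"
          have "Z \<in> \<Y>" using Z by blast
          then obtain i x j where e: "(i, x, j) \<in> set Z"
            using cycle[of Z] by (cases Z) (auto simp: simple_cycle_def)
          have ij: "i \<in> ends Z" "j \<in> ends Z" "i \<noteq> j"
            using arcs_mem(1,2)[OF e] no_loop[of i x j] e \<open>Z \<in> \<Y>\<close> by blast+
          have "i \<noteq> v" "j \<noteq> v" "i \<noteq> w" "j \<noteq> w"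
            using uniq[OF \<open>Z \<in> \<Y>\<close> A(1) _ A(2)] uniq[OF \<open>Z \<in> \<Y>\<close> B(1) _ B(2)] ij Z by blast+
          moreover have "i \<in> ends P \<inter> V" "j \<in> ends P \<inter> V"
            using ij ZP endsV[OF \<open>Z \<in> \<Y>\<close>] by blast+
          ultimately show False using W[OF vW(2) vW(1), of i j] ij(3) vw by blast
        qed
        with True show ?thesis
          using solvable_last_met_once[OF P 1(2) 2(2,3) A B AB first last] by blast
      next
        case False
        then obtain m where m: "m \<in> ends P" "m \<in> ends B" "m \<noteq> w" by blast
        have vm: "v \<noteq> m" using uniq[OF A(1) B(1) A(2)] m(2) AB by blast
        have mW: "m \<in> ends P \<inter> V" using m endsV[OF B(1)] by blast
        have W': "x \<in> {v, w, m}" if "x \<in> ends P \<inter> V" for x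
          using W[OF that vW mW] vw vm m(3) by blast
        have "ends P \<inter> ends A \<subseteq> {v}"
        proof
          fix x assume x: "x \<in> ends P \<inter> ends A"
          then have "x \<noteq> w" "x \<noteq> m" using uniq[OF A(1) B(1), of x] B(2) m(2) AB by blast+
          then show "x \<in> {v}" using W'[of x] x endsV[OF A(1)] by blast
        qed
        moreover have "ends Z \<inter> ends P = {}" if Z: "Z \<in> \<Y> - {A, B}" for Z
        proof (rule ccontr)
          assume "ends Z \<inter> ends P \<noteq> {}"
          then obtain x where x: "x \<in> ends Z" "x \<in> ends P" by blast
          have "Z \<in> \<Y>" "Z \<noteq> A" "Z \<noteq> B" using Z by auto
          then have "x \<notin> ends A" "x \<notin> ends B" using uniq[of Z _ x] x(1) A(1) B(1) by blast+
          then show False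
            using W'[of x] x endsV[OF \<open>Z \<in> \<Y>\<close>] A(2) B(2) m(2) by blast
        qed
        ultimately show ?thesis
          using solvable_first_met_once[OF P 1(2) 2(2,3) A B AB first last] by blast
      qed
    next
      case AB: True
      have wA: "w \<in> ends A" using B(2) AB by simp
      show ?thesis
      proof (cases "\<exists>Z\<in>\<Y> - {A}. ends Z \<inter> ends P \<noteq> {}")
        case True
        then obtain D m where D: "D \<in> \<Y>" "D \<noteq> A" "m \<in> ends D" "m \<in> ends P" by blast
        have mA: "m \<notin> ends A" using uniq[OF D(1) A(1) D(3)] D(2) by blast
        have mV: "m \<in> V" using D(3) endsV[OF D(1)] by blast
        \<comment> \<open>Outside \<open>P2\<close> only \<open>v\<close> and \<open>w\<close> can
          be shared vertices, and both lie on \<open>A\<close>, unlike \<open>m\<close>.\<close>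
        have "ends P1 \<subseteq> insert v (tails P1)" by (rule walk_ends_subset(2)[OF 1(2)])
        then have "m \<notin> ends P1" using 1(5) mV mA A(2) by blast
        moreover have "ends P3 \<subseteq> insert w (heads P3)" by (rule walk_ends_subset(1)[OF 2(3)])
        then have "m \<notin> ends P3" using 2(5) mV mA wA by blast
        ultimately have m2: "m \<in> ends P2" using D(4) unfolding P by auto
        then have m: "m \<in> insert v (heads P2)" using walk_ends_subset(1)[OF 2(2)] by blast
        have "P2 \<noteq> []" using m2 by auto
        \<comment> \<open>Since \<open>P2\<close> contains \<open>m\<close>, it is not empty; with
          \<open>v = w\<close> the path would return to \<open>v\<close>.\<close>
        have vw: "v \<noteq> w"
        proof
          assume "v = w"
          then have v2: "v \<in> heads P2" using walk_in_heads[OF 2(2) \<open>P2 \<noteq> []\<close>] by simp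
          show False
          proof (cases "P1 = []")
            case True
            then have "s = v" using 1(2) by simp
            moreover have "heads P2 \<subseteq> heads P" unfolding P by auto
            ultimately show ?thesis using simple_open_walk_source[OF path] v2 by blast
          next
            case False
            then show ?thesis
              using walk_in_heads[OF 1(2)] v2 path(2) unfolding P by auto
          qed
        qed
        obtain R2 R3 where R: "P2 = R2 @ R3" "walk v R2 m" "walk m R3 w"
          by (rule walk_split_vertex[OF 2(2) m])
        have P': "P = P1 @ R2 @ R3 @ P3" using P R(1) by simp
        have mvw: "v \<noteq> m" "w \<noteq> m" using mA A(2) wA by blast+
        have W': "x \<in> {v, w, m}" if "x \<in> ends P \<inter> V" for x
          using W[OF that vW, of m] D(4) mV vw mvw by blast
        show ?thesis
        proof (rule solvable_first_last_same[OF P' 1(2) R(2,3) 2(3) A wA vw D(1,3) D(2)[symmetric]])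
          show "ends P \<inter> ends A \<subseteq> {v, w}" using W' mA endsV[OF A(1)] by blast
          have "v \<notin> ends D" "w \<notin> ends D"
            using uniq[OF D(1) A(1)] A(2) wA D(2) by blast+
          then show "ends P \<inter> ends D \<subseteq> {m}" using W' endsV[OF D(1)] by blast
          fix Z assume Z: "Z \<in> \<Y> - {A, D}"
          show "ends Z \<inter> ends P = {}"
          proof (rule ccontr)
            assume "ends Z \<inter> ends P \<noteq> {}"
            then obtain x where x: "x \<in> ends Z" "x \<in> ends P" by blast
            have "Z \<in> \<Y>" "Z \<noteq> A" "Z \<noteq> D" using Z by auto
            then have "x \<notin> ends A" "x \<notin> ends D" using uniq[of Z _ x] x(1) A(1) D(1) by blast+
            then show False
              using W'[of x] x endsV[OF \<open>Z \<in> \<Y>\<close>] A(2) wA D(3) by blast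
          qed
        qed (use first last in blast)+
      next
        case False
        then have rest: "\<And>Z. Z \<in> \<Y> - {A} \<Longrightarrow> ends Z \<inter> ends P = {}" by blast
        show ?thesis
        proof (cases "P3 = []")
          case P3: False
          have "P = (P1 @ P2) @ P3" "walk s (P1 @ P2) w" using P 1(2) 2(2) by auto
          then show ?thesis
            using solvable_meets_one_cycle_inner[OF A(1) wA _ _ 2(3) P3 last[OF A(1)] rest] by blast
        next
          case True
          then have tA: "t \<in> ends A" using 2(3) wA by simp
          show ?thesis
          proof (cases "\<Y> = {A}")
            case True
            then show ?thesis by (rule solvable_single_cycle)
          next
            case False
            then obtain Z where "Z \<in> \<Y>" "Z \<noteq> A" using A(1) by blast
            then show ?thesis using solvable_meets_one_cycle_end[OF A(1) tA rest] by blast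
          qed
        qed
      qed
    qed
  qed
qed

end

section \<open>Transfer to clusterings and the lower bound\<close>

theorem theorem2:
  fixes k :: nat and X :: "'a set" and C C' :: "'a set list"
    and Y :: "(nat \<times> 'a \<times> nat) list set" and P :: "(nat \<times> 'a \<times> nat) list"
  assumes "finite X"
    and "clustering k X C" and "clustering k X C'"
    and "Y \<noteq> {}"
    and "\<And>p. p \<in> Y \<Longrightarrow> directed_cycle (CDG k C C') p"
    and "\<And>p q. p \<in> Y \<Longrightarrow> q \<in> Y \<Longrightarrow> p \<noteq> q \<Longrightarrow>
           walk_vertices (CDG k C C') p \<inter> walk_vertices (CDG k C C') q = {}"
    and "directed_path (CDG k C C') P"
    and "set P \<inter> (\<Union>p\<in>Y. set p) = {}"
    and "arcs (CDG k C C') = set P \<union> (\<Union>p\<in>Y. set p)"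
    and "card (walk_vertices (CDG k C C') P \<inter> (\<Union>p\<in>Y. walk_vertices (CDG k C C') p)) \<le> 3"
  shows "transformation_distance k X C C' = 2"
proof -
  define N where "N = {x \<in> X. position C x \<noteq> position C' x}"
  note clusterings = assms(2,3)
  have arcs_N: "arcs (CDG k C C') = arcs_between (position C) (position C') N"
    unfolding arcs_CDG[OF clusterings] N_def arcs_between_def by auto
  obtain s t where st: "P \<noteq> []" "simple P" "s \<noteq> t" "walk s P t"
    using assms(7) unfolding directed_path_CDG by blast
  have cycles: "simple_cycle p" if "p \<in> Y" for p
    using assms(5)[OF that] unfolding directed_cycle_CDG by blast
  have fin_arcs: "finite (arcs (CDG k C C'))"
    unfolding arcs_N arcs_between_def N_def using assms(1) by simp
  \<comment> \<open>Finiteness allows the cycles to be absorbed one by one. It holds because a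
    finite set of arcs has only finitely many distinct lists.\<close>
  have "Y \<subseteq> {p. set p \<subseteq> arcs (CDG k C C') \<and> distinct p}"
    using cycles simple_distinct unfolding simple_cycle_def assms(9) by blast
  then have "finite Y" using finite_subset_distinct[OF fin_arcs] finite_subset by blast
  interpret path_and_cycles "position C" "position C'" N P Y s t
  proof
    show "position C x \<noteq> position C' x" if "x \<in> N" for x using that unfolding N_def by blast
    show "arcs_between (position C) (position C') N = set P \<union> (\<Union>Z\<in>Y. set Z)"
      using arcs_N assms(9) by simp
    show "ends Z \<inter> ends Z' = {}" if "Z \<in> Y" "Z' \<in> Y" "Z \<noteq> Z'" for Z Z'
      using assms(6)[OF that] unfolding walk_vertices_CDG .
    show "set P \<inter> set Z = {}" if "Z \<in> Y" for Z using assms(8) that by blast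
  qed (fact \<open>finite Y\<close> cycles st)+
  have solvable
    using solvable_at_most_three assms(4,10) unfolding walk_vertices_CDG by blast
  then obtain M M' where M: "two_step (position C) (position C') N M M'" "M \<noteq> []" "M' \<noteq> []"
    "ends M \<subseteq> ends P \<union> (\<Union>Z\<in>Y. ends Z)"
    unfolding solvable_def by blast
  have bounded: "ends p \<subseteq> {..<k}" if "set p \<subseteq> arcs (CDG k C C')" for p
    using that by (auto simp: CDG_def tails_def heads_def)
  have "ends P \<union> (\<Union>Z\<in>Y. ends Z) \<subseteq> {..<k}"
  proof -
    have "ends P \<subseteq> {..<k}" using assms(9) by (intro bounded) blast
    moreover have "ends Z \<subseteq> {..<k}" if "Z \<in> Y" for Z using assms(9) that by (intro bounded) blast
    ultimately show ?thesis by blast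
  qed
  then have "heads M \<subseteq> {..<k}" using M(4) by blast
  then have "(move k X OO move k X) C C'"
    by (rule two_step_moves[OF clusterings N_def M(1-3)])
  then have two: "(move k X ^^ 2) C C'" by (simp add: numeral_2_eq_2 eq_OO)
  have "C \<noteq> C'"
  proof
    assume "C = C'"
    then have "arcs (CDG k C C') = {}" unfolding arcs_N N_def arcs_between_def by simp
    then show False using assms(9) st(1) by simp
  qed
  moreover have "\<not> move k X C C'"
  proof
    assume "move k X C C'"
    then obtain p u v where p: "walk u p v" "simple p" "set p = arcs (CDG k C C')"
      unfolding move_iff by blast
    obtain Z where Z: "Z \<in> Y" using assms(4) by blast
    have "set Z \<subseteq> set p" using p(3) assms(9) Z by blast
    \<comment> \<open>The cycle would use up the single move and leave no arc for
      \<open>P\<close>.\<close>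
    then have "set Z = set p" by (rule simple_cycle_subset_eq[OF p(1,2) cycles[OF Z]])
    then have "set P \<subseteq> set Z" using p(3) assms(9) by blast
    moreover have "set P \<inter> set Z = {}" using assms(8) Z by blast
    ultimately show False using st(1) by (simp add: Int_absorb2)
  qed
  ultimately have "2 \<le> n" if "(move k X ^^ n) C C'" for n
    using that by (cases n rule: nat.exhaust; cases "n - 1") (auto simp: eq_OO)
  then show ?thesis
    unfolding transformation_distance_def using two by (rule Least_equality[rotated])
qed

end
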